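(* Let $\mathbb{F}$ be a field, $R=\mathbb{F}[t]$ and $V$ an $R$-module. Let $Z$ be the center of ${\rm L}(V^* )_R$ and $Z_0$ the center of ${\rm L}_R(V)$. Then each $z\in Z$ is of the form $z=c^*$ for some $c\in Z_0$. Moreover, if $V$ is a torsion module, or if $V$ is injective, or if $V$ contains an isomorphic copy of $R$ as a direct summand, then $Z=\{c^*: c\in Z_0\}$.
   Context: $V^*$ is the vector space dual of $V$ (all linear functionals), regarded as an $R$-module by $\langle\rho p,\xi\rangle=\langle\rho,p\xi\rangle$ for $\rho\in V^*$, $p\in R$, $\xi\in V$. ${\rm L}_R(V)$ denotes the algebra of $R$-module endomorphisms of $V$, and ${\rm L}(V^* )_R$ the algebra of $R$-module endomorphisms of $V^*$. For a linear operator $c$ on $V$, $c^*$ is its adjoint on $V^*$, $c^*(\rho)=\rho\circ c$. If $a$ is the operator of multiplication by $t$ on $V$, then $Z_0$ is the bicommutant of $a$ in ${\rm L}(V)$ (all linear operators on $V$) and $Z$ is the bicommutant of $a^*$ in ${\rm L}(V^* )$. *)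

theory Defs
  imports
    "HOL-Computational_Algebra.Polynomial"
    "HOL-Library.FuncSet"
    "HOL-Library.Product_Plus"
begin

text \<open>
  An \<open>\<bbbF>[t]\<close>-module \<open>V\<close> is given by a scalar multiplication \<open>scale\<close> satisfying \<^locale>\<open>module\<close>; the
  field acts through the constant polynomials.
\<close>

definition field_scale :: "('a::field poly \<Rightarrow> 'v \<Rightarrow> 'v) \<Rightarrow> 'a \<Rightarrow> 'v::ab_group_add \<Rightarrow> 'v" where
  "field_scale scale c = scale [:c:]"

lemma vector_space_field_scale:
  assumes "module scale"
  shows "vector_space (field_scale scale)"
proof -
  interpret module scale by fact
  show ?thesis
    by standard
      (simp_all add: field_scale_def scale_right_distrib mult.commute one_pCons[symmetric]
        flip: scale_left_distrib)
qed

definition dual :: "('a::field poly \<Rightarrow> 'v::ab_group_add \<Rightarrow> 'v) \<Rightarrow> ('v \<Rightarrow> 'a) set" where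
  "dual scale = {\<rho>. Vector_Spaces.linear (field_scale scale) (*) \<rho>}"

definition dual_scale ::
    "('a::field poly \<Rightarrow> 'v::ab_group_add \<Rightarrow> 'v) \<Rightarrow> 'a poly \<Rightarrow> ('v \<Rightarrow> 'a) \<Rightarrow> 'v \<Rightarrow> 'a" where
  "dual_scale scale p \<rho> = (\<lambda>\<xi>. \<rho> (scale p \<xi>))"

definition module_endos :: "('a::field poly \<Rightarrow> 'v::ab_group_add \<Rightarrow> 'v) \<Rightarrow> ('v \<Rightarrow> 'v) set" where
  "module_endos scale = {f. module_hom scale scale f}"

text \<open>
  Since the dual is a proper subset of its type, its endomorphisms are taken to be extensional,
  so that equality of operators is equality on the dual.
\<close>

definition dual_endos ::
    "('a::field poly \<Rightarrow> 'v::ab_group_add \<Rightarrow> 'v) \<Rightarrow> (('v \<Rightarrow> 'a) \<Rightarrow> ('v \<Rightarrow> 'a)) set" where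
  "dual_endos scale =
    {T \<in> dual scale \<rightarrow>\<^sub>E dual scale.
      (\<forall>\<rho>\<in>dual scale. \<forall>\<sigma>\<in>dual scale. T (\<lambda>\<xi>. \<rho> \<xi> + \<sigma> \<xi>) = (\<lambda>\<xi>. T \<rho> \<xi> + T \<sigma> \<xi>)) \<and>
      (\<forall>p. \<forall>\<rho>\<in>dual scale. T (dual_scale scale p \<rho>) = dual_scale scale p (T \<rho>))}"

text \<open>The centre of an algebra \<open>L\<close> of operators on \<open>A\<close>, with composition as multiplication.\<close>

definition op_centre :: "'b set \<Rightarrow> ('b \<Rightarrow> 'b) set \<Rightarrow> ('b \<Rightarrow> 'b) set" where
  "op_centre A L = {z \<in> L. \<forall>x\<in>L. compose A z x = compose A x z}"

definition adjoint_op ::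
    "('a::field poly \<Rightarrow> 'v::ab_group_add \<Rightarrow> 'v) \<Rightarrow> ('v \<Rightarrow> 'v) \<Rightarrow> ('v \<Rightarrow> 'a) \<Rightarrow> ('v \<Rightarrow> 'a)" where
  "adjoint_op scale c = (\<lambda>\<rho>\<in>dual scale. \<rho> \<circ> c)"

definition torsion_module :: "('a::field poly \<Rightarrow> 'v::ab_group_add \<Rightarrow> 'v) \<Rightarrow> bool" where
  "torsion_module scale \<longleftrightarrow> (\<forall>\<xi>. \<exists>p. p \<noteq> 0 \<and> scale p \<xi> = 0)"

definition has_free_rank1_summand :: "('a::field poly \<Rightarrow> 'v::ab_group_add \<Rightarrow> 'v) \<Rightarrow> bool" where
  "has_free_rank1_summand scale \<longleftrightarrow>
    (\<exists>A B. module.subspace scale A \<and> module.subspace scale B \<and>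
      A \<inter> B = {0} \<and> (\<forall>\<xi>. \<exists>a\<in>A. \<exists>b\<in>B. \<xi> = a + b) \<and>
      (\<exists>\<phi>. module_hom (*) scale \<phi> \<and> bij_betw \<phi> UNIV A))"

text \<open>
  The extension property of injective modules, for test modules \<open>M\<close> with underlying additive
  group \<open>'m\<close>: every homomorphism to \<open>V\<close> from a submodule \<open>N\<close> of \<open>M\<close> extends to \<open>M\<close>.
\<close>

definition extends_from ::
    "'m::ab_group_add itself \<Rightarrow> ('a::field poly \<Rightarrow> 'v::ab_group_add \<Rightarrow> 'v) \<Rightarrow> bool" where
  "extends_from _ scale \<longleftrightarrow>
    (\<forall>(s :: 'a poly \<Rightarrow> 'm \<Rightarrow> 'm) N f.
      module s \<longrightarrow> module.subspace s N \<longrightarrow>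
      (\<forall>x\<in>N. \<forall>y\<in>N. f (x + y) = f x + f y) \<longrightarrow>
      (\<forall>p. \<forall>x\<in>N. f (s p x) = scale p (f x)) \<longrightarrow>
      (\<exists>g. module_hom s scale g \<and> (\<forall>x\<in>N. g x = f x)))"

text \<open>
  A formula cannot quantify over all types \<open>'m\<close>, so the definition fixes one type that has room
  for both \<open>V\<close> and \<open>\<bbbF>[t]\<close>. This is no restriction: lemma \<open>injective_module_extends_from\<close> derives
  the extension property for test modules of every type.
\<close>

definition injective_module :: "('a::field poly \<Rightarrow> 'v::ab_group_add \<Rightarrow> 'v) \<Rightarrow> bool" where
  "injective_module scale \<longleftrightarrow> extends_from TYPE('v \<times> 'a poly) scale"

lemma injective_module_ideal:
  fixes scale :: "'a::field poly \<Rightarrow> 'v::ab_group_add \<Rightarrow> 'v" and I :: "'a poly set"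
  assumes "module scale" and inj: "injective_module scale"
    and I0: "0 \<in> I" and Iadd: "\<And>p q. p \<in> I \<Longrightarrow> q \<in> I \<Longrightarrow> p + q \<in> I"
    and Imult: "\<And>p q. q \<in> I \<Longrightarrow> p * q \<in> I"
    and fadd: "\<And>p q. p \<in> I \<Longrightarrow> q \<in> I \<Longrightarrow> f (p + q) = f p + f q"
    and fmult: "\<And>p q. q \<in> I \<Longrightarrow> f (p * q) = scale p (f q)"
  shows "\<exists>w. \<forall>p\<in>I. f p = scale p w"
proof -
  interpret V: module scale by fact
  define s :: "'a poly \<Rightarrow> 'v \<times> 'a poly \<Rightarrow> 'v \<times> 'a poly"
    where "s p x = (scale p (fst x), p * snd x)" for p x
  have s: "module s"
    by standard (auto simp: s_def prod_eq_iff algebra_simps)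
  let ?N = "{0} \<times> I"
  have "module.subspace s ?N"
    unfolding module.subspace_def[OF s] by (auto simp: s_def I0 Iadd Imult zero_prod_def)
  moreover have "\<forall>x\<in>?N. \<forall>y\<in>?N. f (snd (x + y)) = f (snd x) + f (snd y)"
    by (auto simp: fadd)
  moreover have "\<forall>p. \<forall>x\<in>?N. f (snd (s p x)) = scale p (f (snd x))"
    by (auto simp: s_def fmult)
  ultimately obtain g where g: "module_hom s scale g" and gf: "\<forall>x\<in>?N. g x = f (snd x)"
    using inj s unfolding injective_module_def extends_from_def
    by (elim allE[of _ s] allE[of _ ?N] allE[of _ "\<lambda>x. f (snd x)"]) auto
  have "f p = scale p (g (0, 1))" if "p \<in> I" for p
  proof -
    have "f p = g (0, p)" using gf that by simp
    also have "(0, p) = s p (0, 1)" by (simp add: s_def)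
    also have "g (s p (0, 1)) = scale p (g (0, 1))"
      by (rule module_hom.scale[OF g])
    finally show ?thesis .
  qed
  then show ?thesis by blast
qed

lemma injective_module_extends_from:
  fixes scale :: "'a::field poly \<Rightarrow> 'v::ab_group_add \<Rightarrow> 'v"
  assumes "module scale" and "injective_module scale"
  shows "extends_from TYPE('m::ab_group_add) scale"
  unfolding extends_from_def
proof (intro allI impI)
  fix s :: "'a poly \<Rightarrow> 'm \<Rightarrow> 'm" and N f
  assume "module s" and N: "module.subspace s N"
    and fadd: "\<forall>x\<in>N. \<forall>y\<in>N. f (x + y) = f x + f y"
    and fscale: "\<forall>p. \<forall>x\<in>N. f (s p x) = scale p (f x)"
  interpret V: module scale by fact
  interpret M: module s by fact
  define good where "good G \<longleftrightarrow> (\<forall>x\<in>N. (x, f x) \<in> G) \<and>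
      (\<forall>x y x' y'. (x, y) \<in> G \<longrightarrow> (x', y') \<in> G \<longrightarrow> (x + x', y + y') \<in> G) \<and>
      (\<forall>p x y. (x, y) \<in> G \<longrightarrow> (s p x, scale p y) \<in> G) \<and>
      (\<forall>y. (0, y) \<in> G \<longrightarrow> y = 0)" for G :: "('m \<times> 'v) set"
  have f0: "f 0 = 0"
    using fscale[rule_format, of 0 0] M.subspace_0[OF N] by simp
  have good0: "good ((\<lambda>x. (x, f x)) ` N)"
    unfolding good_def
    using fadd fscale f0 N by (auto simp: M.subspace_def image_iff)
  have "\<exists>G\<in>Collect good. \<forall>X\<in>Collect good. G \<subseteq> X \<longrightarrow> X = G"
  proof (rule subset_Zorn_nonempty)
    show "Collect good \<noteq> {}" using good0 by blast
    fix C assume ne: "C \<noteq> {}" and ch: "subset.chain (Collect good) C"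
    have C: "\<And>G. G \<in> C \<Longrightarrow> good G" and
      tot: "\<And>G H. G \<in> C \<Longrightarrow> H \<in> C \<Longrightarrow> G \<subseteq> H \<or> H \<subseteq> G"
      using ch by (auto simp: subset.chain_def)
    have "(x + x', y + y') \<in> \<Union>C" if "(x, y) \<in> \<Union>C" "(x', y') \<in> \<Union>C" for x y x' y'
    proof -
      from that obtain G H where "G \<in> C" "H \<in> C" "(x, y) \<in> G" "(x', y') \<in> H" by blast
      then obtain K where "K \<in> C" "(x, y) \<in> K" "(x', y') \<in> K" using tot by blast
      then show ?thesis using C unfolding good_def by blast
    qed
    moreover have "(x, f x) \<in> \<Union>C" if "x \<in> N" for x
      using that ne C unfolding good_def by blast
    moreover have "(s p x, scale p y) \<in> \<Union>C" if "(x, y) \<in> \<Union>C" for p x y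
      using that C unfolding good_def by blast
    moreover have "y = 0" if "(0, y) \<in> \<Union>C" for y
      using that C unfolding good_def by blast
    ultimately show "\<Union>C \<in> Collect good" unfolding good_def by blast
  qed
  then obtain G where G: "good G" and max: "\<And>X. good X \<Longrightarrow> G \<subseteq> X \<Longrightarrow> X = G" by blast
  have GN: "\<And>x. x \<in> N \<Longrightarrow> (x, f x) \<in> G"
    and Gadd: "\<And>x y x' y'. (x, y) \<in> G \<Longrightarrow> (x', y') \<in> G \<Longrightarrow> (x + x', y + y') \<in> G"
    and Gscale: "\<And>p x y. (x, y) \<in> G \<Longrightarrow> (s p x, scale p y) \<in> G"
    and Gzero: "\<And>y. (0, y) \<in> G \<Longrightarrow> y = 0"
    using G unfolding good_def by blast+
  have G0: "(0, 0) \<in> G" using GN[OF M.subspace_0[OF N]] f0 by simp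
  have uniq: "y = y'" if "(x, y) \<in> G" "(x, y') \<in> G" for x y y'
    using Gzero[of "y - y'"] Gadd[OF that(1) Gscale[OF that(2), of "-1"]] by simp
  have total: "\<exists>y. (x, y) \<in> G" for x
  proof -
    define I where "I = {p. \<exists>y. (s p x, y) \<in> G}"
    define h where "h p = (THE y. (s p x, y) \<in> G)" for p
    have h: "(s p x, h p) \<in> G" if "p \<in> I" for p
      using that uniq unfolding I_def h_def by (auto intro: theI2)
    have hI: "h p = y" if "(s p x, y) \<in> G" for p y
      using that uniq unfolding h_def by blast
    have add: "(s (p + q) x, h p + h q) \<in> G" if "p \<in> I" "q \<in> I" for p q
      using Gadd[OF h[OF that(1)] h[OF that(2)]] by (simp add: M.scale_left_distrib)
    have mult: "(s (p * q) x, scale p (h q)) \<in> G" if "q \<in> I" for p q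
      using Gscale[OF h[OF that], of p] by simp
    have "\<exists>w. \<forall>p\<in>I. h p = scale p w"
    proof (rule injective_module_ideal[OF assms])
      show "0 \<in> I" using G0 by (auto simp: I_def)
      show "p + q \<in> I" if "p \<in> I" "q \<in> I" for p q using add[OF that] by (auto simp: I_def)
      show "p * q \<in> I" if "q \<in> I" for p q using mult[OF that] by (auto simp: I_def)
      show "h (p + q) = h p + h q" if "p \<in> I" "q \<in> I" for p q by (rule hI[OF add[OF that]])
      show "h (p * q) = scale p (h q)" if "q \<in> I" for p q by (rule hI[OF mult[OF that]])
    qed
    then obtain w where w: "\<And>p. p \<in> I \<Longrightarrow> h p = scale p w" by blast
    define G' where "G' = {(b + s p x, y + scale p w) | b y p. (b, y) \<in> G}"
    have sub: "G \<subseteq> G'"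
    proof
      fix z assume "z \<in> G"
      then show "z \<in> G'"
        unfolding G'_def by (cases z) (force intro: exI[of _ 0])
    qed
    have "(x1 + x2, y1 + y2) \<in> G'" if 12: "(x1, y1) \<in> G'" "(x2, y2) \<in> G'" for x1 y1 x2 y2
    proof -
      from 12 obtain b c p d e q where "(b, c) \<in> G" "(d, e) \<in> G"
        and "x1 = b + s p x" "y1 = c + scale p w" "x2 = d + s q x" "y2 = e + scale q w"
        unfolding G'_def by blast
      then have "x1 + x2 = (b + d) + s (p + q) x" "y1 + y2 = (c + e) + scale (p + q) w"
        "(b + d, c + e) \<in> G"
        using Gadd by (auto simp: M.scale_left_distrib V.scale_left_distrib)
      then show ?thesis unfolding G'_def by blast
    qed
    moreover have "(s q x1, scale q y1) \<in> G'" if 1: "(x1, y1) \<in> G'" for q x1 y1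
    proof -
      from 1 obtain b c p where "(b, c) \<in> G" "x1 = b + s p x" "y1 = c + scale p w"
        unfolding G'_def by blast
      then have "s q x1 = s q b + s (q * p) x" "scale q y1 = scale q c + scale (q * p) w"
        "(s q b, scale q c) \<in> G"
        using Gscale by (auto simp: M.scale_right_distrib V.scale_right_distrib)
      then show ?thesis unfolding G'_def by blast
    qed
    moreover have "y1 = 0" if 1: "(0, y1) \<in> G'" for y1
    proof -
      from 1 obtain b c p where bc: "(b, c) \<in> G" and b: "0 = b + s p x" and y1: "y1 = c + scale p w"
        unfolding G'_def by blast
      have "- b = s p x" using b by (metis minus_unique)
      then have "(s p x, - c) \<in> G" using Gscale[OF bc, of "-1"] by simp
      then have "p \<in> I" "h p = - c" using hI by (auto simp: I_def)
      then have "scale p w = - c" using w[of p] by simp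
      then show ?thesis using y1 by simp
    qed
    ultimately have "good G'" using sub GN unfolding good_def by blast
    then have "G' = G" using max sub by blast
    moreover have "(0 + s 1 x, 0 + scale 1 w) \<in> G'" unfolding G'_def using G0 by blast
    ultimately show ?thesis by auto
  qed
  define g where "g x = (THE y. (x, y) \<in> G)" for x
  have gI: "g x = y" if "(x, y) \<in> G" for x y
    using that uniq unfolding g_def by blast
  have g: "(x, g x) \<in> G" for x
    using total[of x] gI by blast
  have "module_hom s scale g"
    by standard (auto intro!: gI Gadd Gscale g)
  moreover have "\<forall>x\<in>N. g x = f x" using gI GN by blast
  ultimately show "\<exists>g. module_hom s scale g \<and> (\<forall>x\<in>N. g x = f x)" by blast
qed

end

theory Submission
  imports Defs "HOL-Library.Function_Algebras"
begin

text \<open>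
  Write \<open>R = F[t]\<close> and let \<open>T\<close> be the torsion submodule of \<open>V\<close>. The heart of the matter is to
  show that for a central \<open>z\<close> and a vector \<open>\<xi>\<close> the functional \<open>\<rho> \<mapsto> (z \<rho>) \<xi>\<close> on the dual is
  evaluation at some vector \<open>c \<xi>\<close> (\<open>central_pointwise\<close>). Since the dual separates points, \<open>c\<close> is
  then unique, hence linear, and inherits centrality from \<open>z\<close>.

  For torsion \<open>\<xi>\<close> it suffices that \<open>z\<close> commutes with adjoints: then on each kernel \<open>V[q]\<close> of a
  nonzero polynomial \<open>q\<close> it acts as the adjoint of a single polynomial (\<open>acts_on_kernel_exists\<close>).
  Coprime factors of \<open>q\<close> are treated separately, so let \<open>q = r^(n+1)\<close> with \<open>r\<close> prime. If \<open>r^n V\<close> is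
  not contained in \<open>q V\<close>, then \<open>V\<close> has a direct summand \<open>R/q\<close>, which maps onto every vector of
  \<open>V[q]\<close>. Otherwise \<open>r^n V\<close> is \<open>r\<close>-divisible; either it has no \<open>r\<close>-torsion and \<open>V[q] = V[r^n]\<close>,
  or its \<open>r\<close>-primary part is a nonzero divisible, hence injective, module \<open>D\<close>, and the maps
  \<open>V[q] \<rightarrow> R/q \<subseteq> D\<close> extend to all of \<open>V\<close> and detect every vector of \<open>V[q]\<close>. The required maps
  to and from \<open>R/q\<close> are written down with a Bezoutian.

  If \<open>V\<close> is not torsion, the annihilator \<open>D\<close> of \<open>T\<close> in the dual is divisible and contains a
  nontorsion functional, so a central \<open>z\<close> acts on \<open>D\<close> as a fraction \<open>p/q\<close>
  (\<open>fraction_on_divisible\<close>). The operator \<open>y = q z - p\<close> is killed by every homomorphism from the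
  dual into \<open>D\<close>; as \<open>D\<close> is injective and has nontorsion elements, \<open>y\<close> takes torsion values, and a
  gliding hump argument (\<open>bounded_if_dual_torsion\<close>) bounds them: \<open>s y = 0\<close> for some \<open>s \<noteq> 0\<close>. For
  \<open>q\<close> and \<open>s\<close> of least degree, \<open>D\<close> has neither \<open>q\<close>- nor \<open>s\<close>-torsion, which means \<open>V = T + q V\<close>
  and \<open>V = T + s V\<close>. Splitting \<open>\<xi>\<close> accordingly reduces the claim to torsion vectors.

  Conversely, let \<open>c\<close> be central. If \<open>V\<close> is torsion, \<open>c\<close> is a polynomial on each \<open>V[q]\<close> by the same
  lemma, and functionals vanishing on \<open>V[q]\<close> are multiples of \<open>q\<close>, so \<open>c\<^sup>*\<close> is central. In the
  other two cases \<open>q c = p\<close> for polynomials with \<open>q\<close> acting surjectively, and this relation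
  passes to the dual.
\<close>

section \<open>Ideals and divisibility in the polynomial ring\<close>

lemma poly_ideal_principal:
  fixes I :: "'a::field poly set"
  assumes I0: "0 \<in> I" and Iadd: "\<And>p q. p \<in> I \<Longrightarrow> q \<in> I \<Longrightarrow> p + q \<in> I"
    and Imult: "\<And>p q. q \<in> I \<Longrightarrow> p * q \<in> I"
  shows "\<exists>g\<in>I. \<forall>p\<in>I. g dvd p"
proof (cases "I \<subseteq> {0}")
  case True
  then show ?thesis using I0 by auto
next
  case False
  then have ex: "\<exists>p. p \<in> I \<and> p \<noteq> 0" by blast
  define g where "g = arg_min degree (\<lambda>p. p \<in> I \<and> p \<noteq> 0)"
  have g: "g \<in> I" "g \<noteq> 0" and gmin: "\<And>p. p \<in> I \<Longrightarrow> p \<noteq> 0 \<Longrightarrow> degree g \<le> degree p"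
    using arg_min_natI[of "\<lambda>p. p \<in> I \<and> p \<noteq> 0" _ degree] arg_min_nat_le[of "\<lambda>p. p \<in> I \<and> p \<noteq> 0" _ degree] ex
    unfolding g_def by blast+
  have "g dvd p" if "p \<in> I" for p
  proof -
    have "p mod g = p + (- (p div g)) * g"
      by (simp add: minus_div_mult_eq_mod[symmetric])
    then have "p mod g \<in> I" using Iadd[OF that Imult[OF g(1)]] by metis
    then show ?thesis
      using gmin[of "p mod g"] degree_mod_less[OF g(2), of p] by (metis mod_eq_0_iff_dvd not_less)
  qed
  then show ?thesis using g by blast
qed

text \<open>The generator of the ideal \<open>(x, y)\<close> is a gcd, determined up to a unit.\<close>

lemma poly_bezout:
  fixes x y :: "'a::field poly"
  obtains g a b where "g = a * x + b * y" "g dvd x" "g dvd y"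
proof -
  define J where "J = {a * x + b * y | a b. True}"
  have J: "a * x + b * y \<in> J" for a b unfolding J_def by blast
  have "\<exists>g\<in>J. \<forall>p\<in>J. g dvd p"
  proof (rule poly_ideal_principal)
    show "0 \<in> J" using J[of 0 0] by simp
    show "p + q \<in> J" if pq: "p \<in> J" "q \<in> J" for p q
    proof -
      obtain a b c d where "p = a * x + b * y" "q = c * x + d * y" using pq unfolding J_def by blast
      then show ?thesis using J[of "a + c" "b + d"] by (simp add: algebra_simps)
    qed
    show "p * q \<in> J" if q: "q \<in> J" for p q
    proof -
      obtain a b where "q = a * x + b * y" using q unfolding J_def by blast
      then show ?thesis using J[of "p * a" "p * b"] by (simp add: algebra_simps)
    qed
  qed
  then obtain g where g: "g \<in> J" "\<And>p. p \<in> J \<Longrightarrow> g dvd p" by blast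
  then obtain a b where "g = a * x + b * y" unfolding J_def by blast
  moreover have "g dvd x" "g dvd y" using g(2)[OF J[of 1 0]] g(2)[OF J[of 0 1]] by simp_all
  ultimately show ?thesis using that by blast
qed

lemma poly_dvd_antisym_degree:
  fixes p q :: "'a::field poly"
  assumes "p dvd q" "q \<noteq> 0" "degree q \<le> degree p"
  shows "q dvd p"
proof -
  obtain k where k: "q = p * k" using assms(1) by blast
  then have "p \<noteq> 0" "k \<noteq> 0" "degree k = 0" using assms by (auto simp: degree_mult_eq)
  then have "k dvd 1" by (simp add: is_unit_iff_degree)
  then show ?thesis using k by simp
qed

definition comaximal :: "'a::comm_ring_1 \<Rightarrow> 'a \<Rightarrow> bool" where
  "comaximal x y \<longleftrightarrow> (\<exists>a b. a * x + b * y = 1)"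

lemma comaximal_mult_left:
  assumes "comaximal x y" "comaximal x' y"
  shows "comaximal (x * x') y"
proof -
  from assms obtain a b a' b' where 1: "a * x + b * y = 1" "a' * x' + b' * y = 1"
    unfolding comaximal_def by blast
  have "1 = (a * x + b * y) * (a' * x' + b' * y)" by (simp add: 1)
  also have "\<dots> = (a * a') * (x * x') + (a * x * b' + b * a' * x' + b * b' * y) * y"
    by (simp add: algebra_simps)
  finally show ?thesis unfolding comaximal_def by metis
qed

lemma comaximal_power_left: "comaximal x y \<Longrightarrow> comaximal (x ^ n) y"
  proof (induction n)
  case 0
  have "1 * 1 + 0 * y = 1" by simp
  then show ?case unfolding comaximal_def power_0 by blast
qed (simp add: comaximal_mult_left)

text \<open>
  Irreducibility in the form in which it is used: Bezout's identity holds with every polynomial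
  that is not a multiple.
\<close>

definition comax_prime :: "'a::field poly \<Rightarrow> bool" where
  "comax_prime r \<longleftrightarrow> degree r > 0 \<and> (\<forall>p. \<not> r dvd p \<longrightarrow> comaximal r p)"

lemma comax_prime_divisor:
  fixes q :: "'a::field poly"
  assumes "q \<noteq> 0" "degree q > 0"
  obtains r where "comax_prime r" "r dvd q"
proof -
  define r where "r = arg_min degree (\<lambda>p. p dvd q \<and> degree p > 0)"
  have r: "r dvd q" "degree r > 0" and rmin: "\<And>p. p dvd q \<Longrightarrow> degree p > 0 \<Longrightarrow> degree r \<le> degree p"
    using arg_min_natI[of "\<lambda>p. p dvd q \<and> degree p > 0" q degree]
      arg_min_nat_le[of "\<lambda>p. p dvd q \<and> degree p > 0" _ degree] assms
    unfolding r_def by auto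
  have "comaximal r p" if p: "\<not> r dvd p" for p
  proof -
    obtain g a b where g: "g = a * r + b * p" and gr: "g dvd r" and gp: "g dvd p"
      by (rule poly_bezout)
    have "\<not> degree g > 0"
    proof
      assume "degree g > 0"
      then have "degree r \<le> degree g" using rmin gr r(1) dvd_trans by blast
      then have "r dvd g" using r(2) by (intro poly_dvd_antisym_degree[OF gr]) auto
      then show False using gp p dvd_trans by blast
    qed
    moreover have "g \<noteq> 0" using gr r(2) by auto
    ultimately have "g dvd 1" by (simp add: is_unit_iff_degree)
    then obtain h where h: "1 = g * h" by blast
    then have "(h * a) * r + (h * b) * p = 1" by (simp add: g algebra_simps)
    then show ?thesis unfolding comaximal_def by blast
  qed
  then show ?thesis using that r unfolding comax_prime_def by blast
qed

lemma comax_prime_split: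
  fixes r p :: "'a::field poly"
  assumes "comax_prime r" "p \<noteq> 0"
  obtains n u where "p = r ^ n * u" "comaximal r u"
proof -
  have "\<exists>n u. p = r ^ n * u \<and> comaximal r u" using assms(2)
  proof (induction "degree p" arbitrary: p rule: less_induct)
    case less
    show ?case
    proof (cases "r dvd p")
      case True
      then obtain k where k: "p = r * k" by blast
      then have "k \<noteq> 0" "r \<noteq> 0" using less.prems by auto
      then have "degree k < degree p" using k assms(1) by (simp add: degree_mult_eq comax_prime_def)
      then obtain n u where "k = r ^ n * u" "comaximal r u" using less.hyps \<open>k \<noteq> 0\<close> by blast
      then have "p = r ^ Suc n * u" using k by simp
      then show ?thesis using \<open>comaximal r u\<close> by blast
    next
      case False
      then have "p = r ^ 0 * p" "comaximal r p" using assms(1) by (auto simp: comax_prime_def)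
      then show ?thesis by blast
    qed
  qed
  then show ?thesis using that by blast
qed

text \<open>An ideal containing \<open>r^(n+1)\<close> is generated by a power of \<open>r\<close>, so it cannot be larger than
  \<open>(r^(n+1))\<close> unless it contains \<open>r^n\<close>.\<close>

lemma comax_prime_power_generates:
  fixes r :: "'a::field poly"
  assumes r: "comax_prime r"
    and I0: "0 \<in> I" and Iadd: "\<And>p q. p \<in> I \<Longrightarrow> q \<in> I \<Longrightarrow> p + q \<in> I"
    and Imult: "\<And>p q. q \<in> I \<Longrightarrow> p * q \<in> I"
    and n: "r ^ Suc n \<in> I" "r ^ n \<notin> I" and p: "p \<in> I"
  shows "r ^ Suc n dvd p"
proof (cases "p = 0")
  case False
  then obtain j u where ju: "p = r ^ j * u" and u: "comaximal r u"
    using comax_prime_split[OF r] by blast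
  show ?thesis
  proof (rule ccontr)
    assume "\<not> ?thesis"
    then have j: "j < Suc n" using ju by (meson dvd_mult2 le_imp_power_dvd not_less)
    have "comaximal (r ^ Suc n) u" by (rule comaximal_power_left[OF u])
    then obtain a b where ab: "a * r ^ Suc n + b * u = 1" unfolding comaximal_def by blast
    have "r ^ n = (r ^ (n - j) * r ^ j) * (a * r ^ Suc n + b * u)"
      using ab j by (simp flip: power_add)
    also have "\<dots> = (r ^ (n - j) * r ^ j * a) * r ^ Suc n + (r ^ (n - j) * b) * p"
      by (simp add: ju algebra_simps)
    finally show False using n p Iadd Imult by metis
  qed
qed simp

section \<open>Homomorphisms into divisible modules\<close>

text \<open>
  The dual is a proper subset of a function type, so modules with an explicit carrier are needed
  next to modules on whole types.
\<close>

locale module_on =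
  fixes M :: "'m::ab_group_add set" and s :: "'a::field poly \<Rightarrow> 'm \<Rightarrow> 'm"
  assumes zero_mem [simp]: "0 \<in> M"
    and add_mem [simp]: "x \<in> M \<Longrightarrow> y \<in> M \<Longrightarrow> x + y \<in> M"
    and scale_mem [simp]: "x \<in> M \<Longrightarrow> s p x \<in> M"
    and add_right: "x \<in> M \<Longrightarrow> y \<in> M \<Longrightarrow> s p (x + y) = s p x + s p y"
    and add_left: "x \<in> M \<Longrightarrow> s (p + q) x = s p x + s q x"
    and assoc [simp]: "x \<in> M \<Longrightarrow> s p (s q x) = s (p * q) x"
    and one [simp]: "x \<in> M \<Longrightarrow> s 1 x = x"
begin

lemma zero_left [simp]: "x \<in> M \<Longrightarrow> s 0 x = 0"
  using add_left[of x 0 0] by simp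

lemma zero_right [simp]: "s p 0 = 0"
  using add_right[of 0 0 p] by simp

lemma minus_left: "x \<in> M \<Longrightarrow> s (- p) x = - s p x"
  using add_left[of x p "- p"] by (simp add: eq_neg_iff_add_eq_0 add.commute)

lemma diff_left: "x \<in> M \<Longrightarrow> s (p - q) x = s p x - s q x"
  using add_left[of x p "- q"] by (simp add: minus_left)

lemma annihilator:
  assumes "x \<in> M"
  obtains g where "s g x = 0" "\<And>p. s p x = 0 \<Longrightarrow> g dvd p"
proof -
  have "\<exists>g\<in>{p. s p x = 0}. \<forall>p\<in>{p. s p x = 0}. g dvd p"
  proof (rule poly_ideal_principal)
    show "p * q \<in> {p. s p x = 0}" if "q \<in> {p. s p x = 0}" for p q
      using assoc[OF assms, of p q] that by simp
  qed (use assms in \<open>auto simp: add_left\<close>)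
  then show ?thesis using that by blast
qed

lemma unit_annihilates_zero:
  assumes x: "x \<in> M" "s g x = 0" and "g dvd 1"
  shows "x = 0"
proof -
  obtain k where "1 = g * k" using assms(3) by blast
  then have "s 1 x = s k (s g x)" using x(1) by (simp add: mult.commute)
  then show ?thesis using x by simp
qed

lemma submodule:
  assumes "N \<subseteq> M" "0 \<in> N" "\<And>x y. x \<in> N \<Longrightarrow> y \<in> N \<Longrightarrow> x + y \<in> N"
    "\<And>p x. x \<in> N \<Longrightarrow> s p x \<in> N"
  shows "module_on N s"
  using assms by unfold_locales (auto simp: subset_iff add_right add_left)

end

definition hom_on ::
    "'m::ab_group_add set \<Rightarrow> ('a::field poly \<Rightarrow> 'm \<Rightarrow> 'm) \<Rightarrow>
      'n::ab_group_add set \<Rightarrow> ('a poly \<Rightarrow> 'n \<Rightarrow> 'n) \<Rightarrow> ('m \<Rightarrow> 'n) \<Rightarrow> bool" where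
  "hom_on M s D r g \<longleftrightarrow> (\<forall>x\<in>M. g x \<in> D) \<and> (\<forall>x\<in>M. \<forall>y\<in>M. g (x + y) = g x + g y) \<and>
    (\<forall>p. \<forall>x\<in>M. g (s p x) = r p (g x))"

lemma hom_onI:
  assumes "\<And>x. x \<in> M \<Longrightarrow> g x \<in> D"
    and "\<And>x y. x \<in> M \<Longrightarrow> y \<in> M \<Longrightarrow> g (x + y) = g x + g y"
    and "\<And>p x. x \<in> M \<Longrightarrow> g (s p x) = r p (g x)"
  shows "hom_on M s D r g"
  using assms unfolding hom_on_def by blast

lemma hom_onD:
  assumes "hom_on M s D r g"
  shows "x \<in> M \<Longrightarrow> g x \<in> D" "x \<in> M \<Longrightarrow> y \<in> M \<Longrightarrow> g (x + y) = g x + g y"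
    "x \<in> M \<Longrightarrow> g (s p x) = r p (g x)"
  using assms unfolding hom_on_def by blast+

lemma hom_on_zero: "module_on M s \<Longrightarrow> hom_on M s D r g \<Longrightarrow> g 0 = 0"
  using hom_onD(2)[of M s D r g 0 0] module_on.zero_mem[of M s] by simp

text \<open>
  Divisible modules over a principal ideal domain are injective (Baer's criterion). A partial
  homomorphism is a graph \<open>G \<subseteq> M \<times> D\<close>, maximal by Zorn's lemma. For \<open>x \<in> M\<close> the polynomials
  that carry \<open>x\<close> into the domain form an ideal \<open>(q)\<close>, and dividing the value at \<open>q x\<close> by \<open>q\<close>
  gives an admissible value at \<open>x\<close>.
\<close>

lemma divisible_extension:
  assumes M: "module_on M s" and D: "module_on D r"
    and div: "\<And>q x. q \<noteq> 0 \<Longrightarrow> x \<in> D \<Longrightarrow> \<exists>y\<in>D. r q y = x"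
    and N: "module_on N s" "N \<subseteq> M" and f: "hom_on N s D r f"
  shows "\<exists>g. hom_on M s D r g \<and> (\<forall>x\<in>N. g x = f x)"
proof -
  interpret M: module_on M s by fact
  interpret D: module_on D r by fact
  interpret N: module_on N s by fact
  define good where "good G \<longleftrightarrow> G \<subseteq> M \<times> D \<and> (\<forall>x\<in>N. (x, f x) \<in> G) \<and>
      (\<forall>x y x' y'. (x, y) \<in> G \<longrightarrow> (x', y') \<in> G \<longrightarrow> (x + x', y + y') \<in> G) \<and>
      (\<forall>p x y. (x, y) \<in> G \<longrightarrow> (s p x, r p y) \<in> G) \<and>
      (\<forall>y. (0, y) \<in> G \<longrightarrow> y = 0)" for G
  have f0: "f 0 = 0" by (rule hom_on_zero[OF N(1) f])
  have good0: "good ((\<lambda>x. (x, f x)) ` N)"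
    unfolding good_def
  proof (intro conjI ballI allI impI)
    show "(\<lambda>x. (x, f x)) ` N \<subseteq> M \<times> D" using hom_onD(1)[OF f] N(2) by blast
    show "(x + x', y + y') \<in> (\<lambda>x. (x, f x)) ` N"
      if "(x, y) \<in> (\<lambda>x. (x, f x)) ` N" "(x', y') \<in> (\<lambda>x. (x, f x)) ` N" for x y x' y'
      using that hom_onD(2)[OF f] N.add_mem by force
    show "(s p x, r p y) \<in> (\<lambda>x. (x, f x)) ` N" if "(x, y) \<in> (\<lambda>x. (x, f x)) ` N" for p x y
      using that hom_onD(3)[OF f] N.scale_mem by force
    show "y = 0" if "(0, y) \<in> (\<lambda>x. (x, f x)) ` N" for y using that f0 by force
  qed blast
  have "\<exists>G\<in>Collect good. \<forall>X\<in>Collect good. G \<subseteq> X \<longrightarrow> X = G"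
  proof (rule subset_Zorn_nonempty)
    show "Collect good \<noteq> {}" using good0 by blast
    fix C assume ne: "C \<noteq> {}" and ch: "subset.chain (Collect good) C"
    have C: "\<And>G. G \<in> C \<Longrightarrow> good G" and
      tot: "\<And>G H. G \<in> C \<Longrightarrow> H \<in> C \<Longrightarrow> G \<subseteq> H \<or> H \<subseteq> G"
      using ch by (auto simp: subset.chain_def)
    have "(x + x', y + y') \<in> \<Union>C" if "(x, y) \<in> \<Union>C" "(x', y') \<in> \<Union>C" for x y x' y'
    proof -
      from that obtain G H where "G \<in> C" "H \<in> C" "(x, y) \<in> G" "(x', y') \<in> H" by blast
      then obtain K where "K \<in> C" "(x, y) \<in> K" "(x', y') \<in> K" using tot by blast
      then show ?thesis using C unfolding good_def by blast
    qed
    moreover have "\<Union>C \<subseteq> M \<times> D" using C unfolding good_def by blast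
    moreover have "\<forall>x\<in>N. (x, f x) \<in> \<Union>C" using ne C unfolding good_def by blast
    moreover have "(s p x, r p y) \<in> \<Union>C" if "(x, y) \<in> \<Union>C" for p x y
      using that C unfolding good_def by blast
    moreover have "y = 0" if "(0, y) \<in> \<Union>C" for y using that C unfolding good_def by blast
    ultimately show "\<Union>C \<in> Collect good" unfolding good_def by blast
  qed
  then obtain G where G: "good G" and max: "\<And>X. good X \<Longrightarrow> G \<subseteq> X \<Longrightarrow> X = G" by blast
  have Gsub: "\<And>x y. (x, y) \<in> G \<Longrightarrow> x \<in> M \<and> y \<in> D"
    and GN: "\<And>x. x \<in> N \<Longrightarrow> (x, f x) \<in> G"
    and Gadd: "\<And>x y x' y'. (x, y) \<in> G \<Longrightarrow> (x', y') \<in> G \<Longrightarrow> (x + x', y + y') \<in> G"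
    and Gscale: "\<And>p x y. (x, y) \<in> G \<Longrightarrow> (s p x, r p y) \<in> G"
    and Gzero: "\<And>y. (0, y) \<in> G \<Longrightarrow> y = 0"
    using G unfolding good_def by blast+
  have G0: "(0, 0) \<in> G" using GN[of 0] f0 by simp
  have Gneg: "(- x, - y) \<in> G" if "(x, y) \<in> G" for x y
    using Gscale[OF that, of "- 1"] Gsub[OF that] by (simp add: M.minus_left D.minus_left)
  have uniq: "y = y'" if "(x, y) \<in> G" "(x, y') \<in> G" for x y y'
    using Gzero[of "y - y'"] Gadd[OF that(1) Gneg[OF that(2)]] by simp
  have total: "\<exists>y. (x, y) \<in> G" if x: "x \<in> M" for x
  proof -
    define I where "I = {p. \<exists>y. (s p x, y) \<in> G}"
    have I0: "0 \<in> I" using G0 x by (auto simp: I_def)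
    have Iadd: "p + q \<in> I" if "p \<in> I" "q \<in> I" for p q
      using that Gadd x by (force simp: I_def M.add_left)
    have Imult: "p * q \<in> I" if q: "q \<in> I" for p q
    proof -
      obtain y where "(s q x, y) \<in> G" using q I_def by blast
      then have "(s p (s q x), r p y) \<in> G" by (rule Gscale)
      then show ?thesis using x unfolding I_def by auto
    qed
    obtain q where q: "q \<in> I" and qd: "\<And>p. p \<in> I \<Longrightarrow> q dvd p"
      using poly_ideal_principal[OF I0 Iadd Imult] by blast
    obtain h where h: "(s q x, h) \<in> G" using q I_def by blast
    obtain w where w: "w \<in> D" "r q w = h"
    proof (cases "q = 0")
      case True
      then have "h = 0" using h Gzero x by simp
      then show ?thesis using that[of 0] by simp
    next
      case False
      moreover have "h \<in> D" using h Gsub by blast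
      ultimately show ?thesis using div[of q h] that by blast
    qed
    have Iw: "y = r p w" if "(s p x, y) \<in> G" for p y
    proof -
      have "p \<in> I" using that by (auto simp: I_def)
      then obtain k where "p = q * k" using qd by blast
      then have k: "p = k * q" by (simp add: mult.commute)
      have "(s k (s q x), r k h) \<in> G" by (rule Gscale[OF h])
      then have "(s p x, r p w) \<in> G" using x w k by auto
      then show ?thesis using that uniq by blast
    qed
    \<comment> \<open>The domain of \<open>G'\<close> is enlarged by the multiples of \<open>x\<close>, with value \<open>w\<close> at \<open>x\<close>.\<close>
    define G' where "G' = {(b + s p x, y + r p w) | b y p. (b, y) \<in> G}"
    have sub: "G \<subseteq> G'"
    proof
      fix z assume "z \<in> G"
      then have "(fst z + s 0 x, snd z + r 0 w) \<in> G'" unfolding G'_def by (cases z) auto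
      then show "z \<in> G'" using x w(1) by simp
    qed
    have "(x1 + x2, y1 + y2) \<in> G'" if 12: "(x1, y1) \<in> G'" "(x2, y2) \<in> G'" for x1 y1 x2 y2
    proof -
      from 12 obtain b c p d e q where bc: "(b, c) \<in> G" "(d, e) \<in> G"
        and "x1 = b + s p x" "y1 = c + r p w" "x2 = d + s q x" "y2 = e + r q w"
        unfolding G'_def by blast
      then have "x1 + x2 = (b + d) + s (p + q) x" "y1 + y2 = (c + e) + r (p + q) w"
        using x w by (simp_all add: M.add_left D.add_left)
      then show ?thesis unfolding G'_def using Gadd[OF bc] by blast
    qed
    moreover have "(s q x1, r q y1) \<in> G'" if 1: "(x1, y1) \<in> G'" for q x1 y1
    proof -
      from 1 obtain b c p where bc: "(b, c) \<in> G" "x1 = b + s p x" "y1 = c + r p w"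
        unfolding G'_def by blast
      then have "s q x1 = s q b + s (q * p) x" "r q y1 = r q c + r (q * p) w"
        using Gsub[OF bc(1)] x w by (simp_all add: M.add_right D.add_right)
      then show ?thesis unfolding G'_def using Gscale[OF bc(1)] by blast
    qed
    moreover have "y1 = 0" if 1: "(0, y1) \<in> G'" for y1
    proof -
      from 1 obtain b c p where bc: "(b, c) \<in> G" and b: "0 = b + s p x" and y1: "y1 = c + r p w"
        unfolding G'_def by blast
      have "- b = s p x" using b by (metis minus_unique)
      then have "(s p x, - c) \<in> G" using Gneg[OF bc] by simp
      then show ?thesis using Iw y1 by fastforce
    qed
    moreover have "G' \<subseteq> M \<times> D" using Gsub x w by (auto simp: G'_def)
    ultimately have "good G'" using sub GN unfolding good_def by blast
    then have "G' = G" using max sub by blast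
    moreover have "(0 + s 1 x, 0 + r 1 w) \<in> G'" unfolding G'_def using G0 by blast
    ultimately show ?thesis using x by auto
  qed
  define g where "g x = (THE y. (x, y) \<in> G)" for x
  have gI: "g x = y" if "(x, y) \<in> G" for x y
    using that uniq unfolding g_def by blast
  have g: "(x, g x) \<in> G" if "x \<in> M" for x
    using total[OF that] gI by blast
  have "hom_on M s D r g"
  proof (rule hom_onI)
    show "g x \<in> D" if "x \<in> M" for x using Gsub[OF g[OF that]] by blast
  qed (auto intro!: gI Gadd Gscale g)
  moreover have "\<forall>x\<in>N. g x = f x" using gI GN by blast
  ultimately show ?thesis by blast
qed

lemma divisible_extension_pair:
  assumes M: "module_on M s" and D: "module_on D r"
    and div: "\<And>q x. q \<noteq> 0 \<Longrightarrow> x \<in> D \<Longrightarrow> \<exists>y\<in>D. r q y = x"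
    and w: "v \<in> M" "w \<in> M" and d: "x \<in> D" "y \<in> D"
    and rel: "\<And>p q. s p v + s q w = 0 \<Longrightarrow> r p x + r q y = 0"
  obtains g where "hom_on M s D r g" "g v = x" "g w = y"
proof -
  interpret M: module_on M s by fact
  interpret D: module_on D r by fact
  define N where "N = {s p v + s q w | p q. True}"
  define f where "f u = (SOME z. \<exists>p q. u = s p v + s q w \<and> z = r p x + r q y)" for u
  have f: "f (s p v + s q w) = r p x + r q y" for p q
  proof -
    have "\<exists>p' q'. s p v + s q w = s p' v + s q' w \<and> f (s p v + s q w) = r p' x + r q' y"
      unfolding f_def by (rule someI) blast
    then obtain p' q' where e: "s p v + s q w = s p' v + s q' w"
      and fe: "f (s p v + s q w) = r p' x + r q' y" by blast
    have "s (p - p') v + s (q - q') w = (s p v + s q w) - (s p' v + s q' w)"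
      using w by (simp add: M.diff_left)
    then have "r (p - p') x + r (q - q') y = 0" using e by (intro rel) simp
    moreover have "r (p - p') x + r (q - q') y = (r p x + r q y) - (r p' x + r q' y)"
      using d by (simp add: D.diff_left)
    ultimately show ?thesis using fe by simp
  qed
  have sum: "(s p v + s q w) + (s p' v + s q' w) = s (p + p') v + s (q + q') w" for p q p' q'
    using w by (simp add: M.add_left)
  have sum': "(r p x + r q y) + (r p' x + r q' y) = r (p + p') x + r (q + q') y" for p q p' q'
    using d by (simp add: D.add_left)
  have scal: "s k (s p v + s q w) = s (k * p) v + s (k * q) w" for k p q using w by (simp add: M.add_right)
  have scal': "r k (r p x + r q y) = r (k * p) x + r (k * q) y" for k p q using d by (simp add: D.add_right)
  have N: "N \<subseteq> M" unfolding N_def using w by auto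
  have "s 0 v + s 0 w = 0" using w by simp
  then have "0 \<in> N" unfolding N_def by (metis (mono_tags, lifting) mem_Collect_eq)
  then have N': "module_on N s"
    using sum scal by (intro M.submodule[OF N]) (unfold N_def, blast+)
  have f': "hom_on N s D r f"
  proof (intro hom_onI)
    fix u assume "u \<in> N"
    then obtain p q where u: "u = s p v + s q w" unfolding N_def by blast
    show "f u \<in> D" unfolding u f using d by simp
    show "f (s k u) = r k (f u)" for k unfolding u scal f scal' ..
    fix u' assume "u' \<in> N"
    then obtain p' q' where u': "u' = s p' v + s q' w" unfolding N_def by blast
    show "f (u + u') = f u + f u'" unfolding u u' sum f sum' ..
  qed
  obtain g where g: "hom_on M s D r g" "\<And>x. x \<in> N \<Longrightarrow> g x = f x"
    using divisible_extension[OF M D div N' N f'] by blast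
  have *: "s 1 v + s 0 w = v" "s 0 v + s 1 w = w" "r 1 x + r 0 y = x" "r 0 x + r 1 y = y"
    using w d by simp_all
  have "v \<in> N" "w \<in> N" unfolding N_def using * by (metis (mono_tags, lifting) mem_Collect_eq)+
  then have "g v = x" "g w = y" using g(2) f[of 1 0] f[of 0 1] * by metis+
  then show ?thesis using that g(1) by blast
qed

lemma divisible_extension_cyclic:
  assumes M: "module_on M s" and D: "module_on D r"
    and div: "\<And>q x. q \<noteq> 0 \<Longrightarrow> x \<in> D \<Longrightarrow> \<exists>y\<in>D. r q y = x"
    and w: "v \<in> M" and d: "x \<in> D"
    and rel: "\<And>p. s p v = 0 \<Longrightarrow> r p x = 0"
  obtains g where "hom_on M s D r g" "g v = x"
proof -
  note 0 = module_on.zero_mem[OF M] module_on.zero_mem[OF D]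
  have "r p x + r q 0 = 0" if "s p v + s q 0 = 0" for p q
    using that rel module_on.zero_right[OF M] module_on.zero_right[OF D] by simp
  then show ?thesis using divisible_extension_pair[OF M D div w 0(1) d 0(2)] that by blast
qed

text \<open>
  If \<open>d\<close> and \<open>z d\<close> were independent, some homomorphism into \<open>D\<close> would send \<open>d\<close> to \<open>0\<close> and \<open>z d\<close> to
  \<open>d\<close>, contradicting commutation. So \<open>q (z d) = p d\<close>, and this relation spreads from \<open>d\<close> to every
  element of \<open>D\<close>, because all of them are images of the nontorsion element \<open>d\<close>.
\<close>

lemma fraction_on_divisible:
  fixes s :: "'a::field poly \<Rightarrow> 'm::ab_group_add \<Rightarrow> 'm"
  assumes M: "module_on M s" and D: "module_on D s" "D \<subseteq> M"
    and div: "\<And>q x. q \<noteq> 0 \<Longrightarrow> x \<in> D \<Longrightarrow> \<exists>y\<in>D. s q y = x"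
    and z: "hom_on M s M s z"
    and comm: "\<And>g x. hom_on M s D s g \<Longrightarrow> x \<in> M \<Longrightarrow> z (g x) = g (z x)"
    and d: "d \<in> D" "\<And>q. q \<noteq> 0 \<Longrightarrow> s q d \<noteq> 0"
  obtains p q where "q \<noteq> 0" "\<And>x. x \<in> D \<Longrightarrow> s q (z x) = s p x"
proof -
  interpret M: module_on M s by fact
  interpret D: module_on D s by fact
  have dM: "d \<in> M" "z d \<in> M" using d D hom_onD(1)[OF z] by auto
  have "\<exists>p q. q \<noteq> 0 \<and> s q (z d) = s p d"
  proof (rule ccontr)
    assume no: "\<not> ?thesis"
    have rel: "s p 0 + s q d = 0" if "s p d + s q (z d) = 0" for p q
    proof -
      have "s q (z d) = s (- p) d" using that M.minus_left[OF dM(1), of p]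
        by (simp add: minus_unique)
      then have "q = 0" using no by blast
      then show ?thesis using dM by simp
    qed
    obtain g where g: "hom_on M s D s g" "g d = 0" "g (z d) = d"
      using divisible_extension_pair[OF M D(1) div dM D.zero_mem d(1) rel] by blast
    then have "d = z 0" using comm[OF g(1) dM(1)] by simp
    then have "d = 0" using hom_on_zero[OF M z] by simp
    then show False using d(2)[of 1] by simp
  qed
  then obtain p q where q: "q \<noteq> 0" and pq: "s q (z d) = s p d" by blast
  have "s q (z x) = s p x" if x: "x \<in> D" for x
  proof -
    have "s p x = 0" if "s p d = 0" for p
    proof -
      have "p = 0" using that d(2) by blast
      then show ?thesis using x by simp
    qed
    then obtain g where g: "hom_on M s D s g" "g d = x"
      using divisible_extension_cyclic[OF M D(1) div dM(1) x] by blast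
    have "s q (z x) = s q (g (z d))" using comm[OF g(1) dM(1)] g(2) by simp
    also have "\<dots> = g (s q (z d))" using hom_onD(3)[OF g(1) dM(2)] by simp
    also have "\<dots> = s p x" using hom_onD(3)[OF g(1) dM(1)] g(2) pq by simp
    finally show ?thesis .
  qed
  then show ?thesis using q that by blast
qed

section \<open>Linear functionals\<close>

locale poly_module = module scale
  for scale :: "'a::field poly \<Rightarrow> 'v::ab_group_add \<Rightarrow> 'v"
begin

abbreviation "V' \<equiv> dual scale"
abbreviation "act \<equiv> dual_scale scale"

lemma field_scale_vector_space: "vector_space (field_scale scale)"
  by (rule vector_space_field_scale) unfold_locales

lemma module_on_UNIV: "module_on UNIV scale"
  by unfold_locales (auto simp: scale_right_distrib scale_left_distrib)

lemma dual_iff: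
  "\<rho> \<in> V' \<longleftrightarrow> (\<forall>x y. \<rho> (x + y) = \<rho> x + \<rho> y) \<and> (\<forall>c x. \<rho> (scale [:c:] x) = c * \<rho> x)"
proof -
  interpret F: vector_space "field_scale scale" by (rule field_scale_vector_space)
  interpret K: vector_space "(*) :: 'a \<Rightarrow> 'a \<Rightarrow> 'a" by unfold_locales (auto simp: algebra_simps)
  show ?thesis
    unfolding dual_def linear_iff_module_hom module_hom_iff
    using F.module_axioms K.module_axioms by (auto simp: field_scale_def)
qed

lemma dual_add: "\<rho> \<in> V' \<Longrightarrow> \<rho> (x + y) = \<rho> x + \<rho> y"
  and dual_const: "\<rho> \<in> V' \<Longrightarrow> \<rho> (scale [:c:] x) = c * \<rho> x"
  by (simp_all add: dual_iff)

lemma dual_smult: "\<rho> \<in> V' \<Longrightarrow> \<rho> (scale (smult c p) x) = c * \<rho> (scale p x)"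
  using dual_const[of \<rho> c "scale p x"] by simp

lemma dual_zero [simp]: "\<rho> \<in> V' \<Longrightarrow> \<rho> 0 = 0"
  using dual_add[of \<rho> 0 0] by (metis add_0 add_cancel_right_left)

lemma dual_minus: "\<rho> \<in> V' \<Longrightarrow> \<rho> (- x) = - \<rho> x"
  using dual_add[of \<rho> x "- x"] by (simp add: eq_neg_iff_add_eq_0 add.commute)

lemma dual_diff: "\<rho> \<in> V' \<Longrightarrow> \<rho> (x - y) = \<rho> x - \<rho> y"
  using dual_add[of \<rho> x "- y"] by (simp add: dual_minus)

lemma dual_sum: "\<rho> \<in> V' \<Longrightarrow> \<rho> (\<Sum>i\<in>A. f i) = (\<Sum>i\<in>A. \<rho> (f i))"
  by (induction A rule: infinite_finite_induct) (auto simp: dual_add)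

lemma dual_comp_hom: "\<rho> \<in> V' \<Longrightarrow> module_hom scale scale f \<Longrightarrow> \<rho> \<circ> f \<in> V'"
  by (simp add: dual_iff module_hom.add module_hom.scale)

lemma dual_diff_mem: "\<rho> \<in> V' \<Longrightarrow> \<sigma> \<in> V' \<Longrightarrow> \<rho> - \<sigma> \<in> V'"
  by (auto simp: dual_iff algebra_simps)

lemma act_apply: "act p \<rho> x = \<rho> (scale p x)"
  by (simp add: dual_scale_def)

lemma module_on_dual: "module_on V' act"
proof
  show "0 \<in> V'" by (simp add: dual_iff)
  show "\<rho> + \<sigma> \<in> V'" if "\<rho> \<in> V'" "\<sigma> \<in> V'" for \<rho> \<sigma>
    using that by (simp add: dual_iff algebra_simps)
  show "act p \<rho> \<in> V'" if "\<rho> \<in> V'" for p \<rho>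
    using dual_smult[OF that] dual_add[OF that] by (simp add: dual_iff act_apply scale_right_distrib)
  show "act (p + q) \<rho> = act p \<rho> + act q \<rho>" if "\<rho> \<in> V'" for p q \<rho>
    using that by (auto simp: act_apply scale_left_distrib dual_add)
  show "act p (act q \<rho>) = act (p * q) \<rho>" for p q \<rho>
    by (auto simp: act_apply mult.commute)
qed (auto simp: act_apply)

text \<open>The values prescribed on \<open>f M\<close> by \<open>\<delta>\<close> and on \<open>W\<close> by \<open>0\<close> are compatible exactly when \<open>\<delta>\<close> vanishes
  on the preimage of \<open>W\<close>; a linear projection onto \<open>f M + W\<close> extends the result to \<open>V\<close>.\<close>

lemma functional_extension:
  assumes s: "module s" and f: "module_hom s scale f" and W: "subspace W"
    and d: "\<delta> \<in> dual s" "\<And>m. f m \<in> W \<Longrightarrow> \<delta> m = 0"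
  obtains \<rho> where "\<rho> \<in> V'" "\<And>m. \<rho> (f m) = \<delta> m" "\<And>w. w \<in> W \<Longrightarrow> \<rho> w = 0"
proof -
  interpret M: module s by fact
  interpret M: poly_module s ..
  interpret f: module_hom s scale f by fact
  interpret F: vector_space "field_scale scale" by (rule field_scale_vector_space)
  interpret FF: vector_space_pair "field_scale scale" "field_scale scale" ..
  define U where "U = {f m + w | m w. w \<in> W}"
  have mk: "f m + w \<in> U" if "w \<in> W" for m w using that unfolding U_def by blast
  have add: "(f m + w) + (f m' + w') = f (m + m') + (w + w')" for m w m' w'
    by (simp add: f.add)
  have scal: "scale p (f m + w) = f (s p m) + scale p w" for p m w
    by (simp add: f.scale scale_right_distrib)
  note Ws = subspace_0[OF W] subspace_add[OF W] subspace_scale[OF W] subspace_diff[OF W]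
  have "F.subspace U"
    unfolding F.subspace_def
  proof (intro conjI ballI allI)
    show "0 \<in> U" using mk[of 0 0] Ws by (simp add: f.zero)
    show "x + y \<in> U" if "x \<in> U" "y \<in> U" for x y
      using that mk add Ws unfolding U_def by blast
    show "field_scale scale c x \<in> U" if "x \<in> U" for c x
      using that mk scal Ws unfolding U_def field_scale_def by blast
  qed
  moreover have "Vector_Spaces.linear (field_scale scale) (field_scale scale) (\<lambda>x. x)"
    by (rule F.linear_ident)
  ultimately obtain \<pi> where pi: "range \<pi> \<subseteq> U" "\<And>u. u \<in> U \<Longrightarrow> \<pi> u = u"
    and lin: "Vector_Spaces.linear (field_scale scale) (field_scale scale) \<pi>"
    using FF.linear_exists_left_inverse_on[of "\<lambda>x. x" U] by auto
  interpret \<pi>: module_hom "field_scale scale" "field_scale scale" \<pi>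
    using lin by (simp add: linear_iff_module_hom)
  define \<theta> where "\<theta> u = \<delta> (SOME m. \<exists>w\<in>W. u = f m + w)" for u
  have \<theta>: "\<theta> (f m + w) = \<delta> m" if w: "w \<in> W" for m w
  proof -
    define m' where "m' = (SOME m'. \<exists>w'\<in>W. f m + w = f m' + w')"
    have "\<exists>w'\<in>W. f m + w = f m' + w'"
      unfolding m'_def by (rule someI[of _ m]) (use w in blast)
    then obtain w' where w': "w' \<in> W" "f m + w = f m' + w'" by blast
    have "f (m' - m) = w - w'" using w'(2) by (simp add: f.diff algebra_simps)
    then have "\<delta> (m' - m) = 0" using d(2) Ws w w' by simp
    then show ?thesis using M.dual_diff[OF d(1)] unfolding \<theta>_def m'_def by simp
  qed
  have "\<theta> \<circ> \<pi> \<in> V'"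
    unfolding dual_iff o_apply
  proof (intro conjI allI)
    fix x y c
    obtain m w where x: "\<pi> x = f m + w" "w \<in> W" using pi(1) unfolding U_def by blast
    obtain m' w' where y: "\<pi> y = f m' + w'" "w' \<in> W" using pi(1) unfolding U_def by blast
    have "\<pi> (x + y) = f (m + m') + (w + w')" using x y by (simp add: \<pi>.add f.add)
    then show "\<theta> (\<pi> (x + y)) = \<theta> (\<pi> x) + \<theta> (\<pi> y)"
      using x y Ws by (simp add: \<theta> M.dual_add[OF d(1)])
    have "\<pi> (scale [:c:] x) = f (s [:c:] m) + scale [:c:] w"
      using \<pi>.scale[of c x] x by (simp add: field_scale_def scal)
    then show "\<theta> (\<pi> (scale [:c:] x)) = c * \<theta> (\<pi> x)"
      using x Ws by (simp add: \<theta> M.dual_const[OF d(1)])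
  qed
  moreover have "(\<theta> \<circ> \<pi>) (f m) = \<delta> m" for m
    using pi(2)[OF mk[of 0 m]] \<theta>[of 0 m] Ws by simp
  moreover have "(\<theta> \<circ> \<pi>) w = 0" if "w \<in> W" for w
    using pi(2)[OF mk[of w 0]] \<theta>[of w 0] that d(1) by (simp add: f.zero)
  ultimately show ?thesis using that by blast
qed

lemma module_poly: "module ((*) :: 'a poly \<Rightarrow> 'a poly \<Rightarrow> 'a poly)"
  by unfold_locales (auto simp: algebra_simps)

lemma dual_poly_iff:
  "\<delta> \<in> dual ((*) :: 'a poly \<Rightarrow> 'a poly \<Rightarrow> 'a poly) \<longleftrightarrow>
    (\<forall>p q. \<delta> (p + q) = \<delta> p + \<delta> q) \<and> (\<forall>c p. \<delta> (smult c p) = c * \<delta> p)"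
proof -
  interpret P: module "(*) :: 'a poly \<Rightarrow> 'a poly \<Rightarrow> 'a poly" by (rule module_poly)
  interpret P: poly_module "(*) :: 'a poly \<Rightarrow> 'a poly \<Rightarrow> 'a poly" ..
  show ?thesis by (simp add: P.dual_iff)
qed

text \<open>The special case of the homomorphism \<open>p \<mapsto> p v\<close> from the polynomial ring.\<close>

lemma functional_on_cyclic:
  assumes W: "subspace W" and d: "\<delta> \<in> dual ((*) :: 'a poly \<Rightarrow> 'a poly \<Rightarrow> 'a poly)"
    "\<And>p. scale p v \<in> W \<Longrightarrow> \<delta> p = 0"
  obtains \<rho> where "\<rho> \<in> V'" "\<And>p. \<rho> (scale p v) = \<delta> p" "\<And>w. w \<in> W \<Longrightarrow> \<rho> w = 0"
proof (rule functional_extension[OF module_poly _ W d])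
  show "module_hom (*) scale (\<lambda>p. scale p v)"
    by (intro module_hom_iff[THEN iffD2] conjI module_poly)
      (auto simp: scale_left_distrib module_axioms)
qed (use that in blast)+

lemma scale_hom: "module_hom scale scale (scale q)"
  by (auto simp: module_hom_iff module_axioms scale_right_distrib mult.commute)

text \<open>The annihilator of \<open>V[q]\<close> in the dual is \<open>q\<close> times the dual: a functional that vanishes on the
  kernel of \<open>q\<close> factors through \<open>q V\<close>.\<close>

lemma vanishing_on_kernel:
  assumes "\<delta> \<in> V'" "\<And>v. scale q v = 0 \<Longrightarrow> \<delta> v = 0"
  obtains \<rho> where "\<rho> \<in> V'" "\<delta> = act q \<rho>"
proof -
  obtain \<rho> where "\<rho> \<in> V'" "\<And>v. \<rho> (scale q v) = \<delta> v"
    using functional_extension[OF module_axioms scale_hom[of q] subspace_single_0 assms(1)] assms(2)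
    by (metis singletonD)
  then show ?thesis using that by (auto simp: act_apply fun_eq_iff)
qed

lemma annihilator_ideal:
  assumes "subspace W"
  obtains g where "scale g v \<in> W" "\<And>p. scale p v \<in> W \<Longrightarrow> g dvd p"
proof -
  have "\<exists>g\<in>{p. scale p v \<in> W}. \<forall>p\<in>{p. scale p v \<in> W}. g dvd p"
  proof (rule poly_ideal_principal)
    show "p * q \<in> {p. scale p v \<in> W}" if "q \<in> {p. scale p v \<in> W}" for p q
      using subspace_scale[OF assms, of "scale q v" p] that by simp
  qed (auto simp: scale_left_distrib subspace_0[OF assms] subspace_add[OF assms])
  then show ?thesis using that by blast
qed

lemma separation:
  assumes W: "subspace W" and v: "v \<notin> W"
  obtains \<rho> where "\<rho> \<in> V'" "\<rho> v \<noteq> 0" "\<And>w. w \<in> W \<Longrightarrow> \<rho> w = 0"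
proof -
  obtain g where g: "scale g v \<in> W" "\<And>p. scale p v \<in> W \<Longrightarrow> g dvd p"
    using annihilator_ideal[OF W, of v] by blast
  have nu: "\<not> g dvd 1"
  proof
    assume "g dvd 1"
    then obtain h where "1 = h * g" by (metis dvd_def mult.commute)
    then have "v = scale h (scale g v)" by (metis scale_one scale_scale)
    then show False using v g(1) subspace_scale[OF W] by metis
  qed
  define \<delta> where "\<delta> p = coeff (p mod g) 0" for p
  have "\<delta> \<in> dual (*)" by (simp add: dual_poly_iff \<delta>_def poly_mod_add_left mod_smult_left)
  moreover have "\<delta> p = 0" if "scale p v \<in> W" for p using g(2)[OF that] by (simp add: \<delta>_def)
  ultimately obtain \<rho> where \<rho>: "\<rho> \<in> V'" "\<And>p. \<rho> (scale p v) = \<delta> p" "\<And>w. w \<in> W \<Longrightarrow> \<rho> w = 0"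
    using functional_on_cyclic[OF W] by metis
  have "(1 :: 'a poly) mod g = 1"
  proof (cases "g = 0")
    case False
    then have "degree g > 0" using nu by (simp add: is_unit_iff_degree)
    then show ?thesis by (intro mod_poly_less) simp
  qed simp
  then have "\<rho> v \<noteq> 0" using \<rho>(2)[of 1] by (simp add: \<delta>_def)
  then show ?thesis using that \<rho> by blast
qed

lemma dual_eqI:
  assumes "\<And>\<rho>. \<rho> \<in> V' \<Longrightarrow> \<rho> x = \<rho> y"
  shows "x = y"
proof (rule ccontr)
  assume "x \<noteq> y"
  then have "x - y \<notin> {0}" by simp
  then obtain \<rho> where "\<rho> \<in> V'" "\<rho> (x - y) \<noteq> 0" using separation[OF subspace_single_0] by metis
  then show False using assms by (simp add: dual_diff)
qed

section \<open>Bezoutians and finite rank endomorphisms\<close>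

text \<open>
  Here \<open>poly_shift (Suc k) Q\<close> is the quotient of \<open>Q\<close> by \<open>t^(k+1)\<close>, and the sum over \<open>k\<close> of
  \<open>x^k \<cdot> poly_shift (Suc k) Q\<close> is the Bezoutian \<open>(Q(t) - Q(x)) / (t - x)\<close>. In it, the powers of \<open>x\<close>
  are applied to \<open>w\<close> and then evaluated by \<open>\<sigma>\<close>. If \<open>Q \<sigma> = 0\<close>, the
  resulting polynomial valued map is linear over the polynomial ring modulo \<open>Q\<close>.
\<close>

definition bezoutian :: "'a poly \<Rightarrow> ('v \<Rightarrow> 'a) \<Rightarrow> 'v \<Rightarrow> 'a poly" where
  "bezoutian Q \<sigma> w = (\<Sum>k<degree Q. smult (\<sigma> (scale (monom 1 k) w)) (poly_shift (Suc k) Q))"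

lemma poly_shift_step:
  fixes Q :: "'a poly"
  shows "[:0, 1:] * poly_shift (Suc k) Q = poly_shift k Q - [:coeff Q k:]"
  by (rule poly_eqI) (auto simp: coeff_poly_shift coeff_pCons split: nat.splits)

lemma const_poly_sum:
  fixes f :: "'i \<Rightarrow> 'a"
  shows "[:\<Sum>k\<in>A. f k:] = (\<Sum>k\<in>A. [:f k:])"
proof (induction A rule: infinite_finite_induct)
  case (insert x F)
  have "[:f x + sum f F:] = [:f x:] + [:sum f F:]" by simp
  then show ?case using insert by simp
qed auto

lemma smult_sum_right:
  fixes f :: "'i \<Rightarrow> 'a poly"
  shows "smult c (\<Sum>k\<in>A. f k) = (\<Sum>k\<in>A. smult c (f k))"
  by (induction A rule: infinite_finite_induct) (auto simp: smult_add_right)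

lemma poly_shift_degree:
  fixes Q :: "'a poly"
  shows "poly_shift (degree Q) Q = [:lead_coeff Q:]"
  by (rule poly_eqI) (auto simp: coeff_poly_shift coeff_pCons coeff_eq_0 split: nat.splits)

text \<open>The identity \<open>(t - x) \<cdot> (Q(t) - Q(x)) / (t - x) = Q(t) - Q(x)\<close>: the failure of the map to commute
  with \<open>t\<close> is a multiple of \<open>Q\<close> as soon as \<open>\<sigma>\<close> kills \<open>Q w\<close>.\<close>

lemma bezoutian_shift:
  assumes \<sigma>: "\<sigma> \<in> V'"
  shows "bezoutian Q \<sigma> (scale [:0, 1:] w) = [:0, 1:] * bezoutian Q \<sigma> w + [:\<sigma> (scale Q w):] - smult (\<sigma> w) Q"
proof -
  define a where "a k = \<sigma> (scale (monom 1 k) w)" for k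
  define S where "S k = poly_shift k Q" for k
  let ?d = "degree Q"
  have "\<sigma> (scale (monom 1 k) (scale [:0, 1:] w)) = a (Suc k)" for k
    by (simp add: a_def monom_Suc mult.commute)
  then have 1: "bezoutian Q \<sigma> (scale [:0, 1:] w) = (\<Sum>k<?d. smult (a (Suc k)) (S (Suc k)))"
    by (simp add: bezoutian_def S_def)
  have "[:0, 1:] * bezoutian Q \<sigma> w = (\<Sum>k<?d. smult (a k) ([:0, 1:] * S (Suc k)))"
    by (simp add: bezoutian_def sum_distrib_left a_def S_def del: mult_pCons_left)
  also have "\<dots> = (\<Sum>k<?d. smult (a k) (S k) - [:a k * coeff Q k:])"
    unfolding S_def poly_shift_step by (simp add: smult_diff_right)
  finally have 2: "[:0, 1:] * bezoutian Q \<sigma> w = (\<Sum>k<?d. smult (a k) (S k)) - (\<Sum>k<?d. [:a k * coeff Q k:])"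
    by (simp add: sum_subtractf)
  have "scale Q w = (\<Sum>k\<le>?d. scale (monom (coeff Q k) k) w)"
    by (subst poly_as_sum_of_monoms[symmetric]) (simp only: scale_sum_left)
  also have "\<dots> = (\<Sum>k\<le>?d. scale [:coeff Q k:] (scale (monom 1 k) w))"
    by (simp add: smult_monom)
  finally have "\<sigma> (scale Q w) = (\<Sum>k\<le>?d. coeff Q k * a k)"
    by (simp only: dual_sum[OF \<sigma>] dual_const[OF \<sigma>] a_def)
  then have "[:\<sigma> (scale Q w):] = (\<Sum>k\<le>?d. [:a k * coeff Q k:])"
    by (simp add: const_poly_sum mult.commute)
  also have "\<dots> = (\<Sum>k<?d. [:a k * coeff Q k:]) + smult (a ?d) (S ?d)"
    by (simp add: S_def poly_shift_degree flip: lessThan_Suc_atMost)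
  finally have 3: "[:\<sigma> (scale Q w):] = (\<Sum>k<?d. [:a k * coeff Q k:]) + smult (a ?d) (S ?d)" .
  have 4: "(\<Sum>k<?d. smult (a (Suc k)) (S (Suc k))) + smult (a 0) Q
     = (\<Sum>k<?d. smult (a k) (S k)) + smult (a ?d) (S ?d)"
    using sum.lessThan_Suc_shift[of "\<lambda>k. smult (a k) (S k)" ?d] by (simp add: S_def add.commute)
  have "a 0 = \<sigma> w" by (simp add: a_def)
  then show ?thesis using 1 2 3 4 by (simp add: algebra_simps)
qed

lemma bezoutian_add: "\<sigma> \<in> V' \<Longrightarrow> bezoutian Q \<sigma> (v + w) = bezoutian Q \<sigma> v + bezoutian Q \<sigma> w"
  by (simp add: bezoutian_def scale_right_distrib dual_add smult_add_left sum.distrib)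

lemma bezoutian_const: "\<sigma> \<in> V' \<Longrightarrow> bezoutian Q \<sigma> (scale [:c:] w) = smult c (bezoutian Q \<sigma> w)"
  by (simp add: bezoutian_def dual_smult smult_sum_right mult.commute[of _ "[:c:]"])

lemma bezoutian_scale_mod:
  assumes \<sigma>: "\<sigma> \<in> V'" and Q: "\<And>p. \<sigma> (scale (Q * p) w) = 0"
  shows "Q dvd bezoutian Q \<sigma> (scale p w) - p * bezoutian Q \<sigma> w"
proof (induction p)
  case 0
  show ?case using bezoutian_const[OF \<sigma>, of Q 0] by simp
next
  case (pCons a p)
  let ?w = "scale p w"
  have "scale (pCons a p) w = scale [:a:] w + scale [:0, 1:] ?w"
    by (simp flip: scale_left_distrib)
  then have "bezoutian Q \<sigma> (scale (pCons a p) w) = smult a (bezoutian Q \<sigma> w) + [:0, 1:] * bezoutian Q \<sigma> ?w - smult (\<sigma> ?w) Q"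
    using bezoutian_shift[OF \<sigma>, of Q ?w] Q[of p] bezoutian_add[OF \<sigma>] bezoutian_const[OF \<sigma>] by simp
  moreover have "pCons a p * bezoutian Q \<sigma> w = smult a (bezoutian Q \<sigma> w) + [:0, 1:] * (p * bezoutian Q \<sigma> w)"
    by simp
  ultimately have "bezoutian Q \<sigma> (scale (pCons a p) w) - pCons a p * bezoutian Q \<sigma> w
      = [:0, 1:] * (bezoutian Q \<sigma> ?w - p * bezoutian Q \<sigma> w) - smult (\<sigma> ?w) Q"
    by (simp add: algebra_simps del: mult_pCons_left mult_pCons_right)
  then show ?case using pCons.IH by (metis dvd_diff dvd_mult dvd_refl dvd_smult)
qed

text \<open>Hence \<open>w \<mapsto> bezoutian Q \<sigma> w \<cdot> v\<close> is a module homomorphism for \<open>v \<in> V[Q]\<close>, on any submodule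
  on which \<open>\<sigma>\<close> annihilates all multiples of \<open>Q\<close>.\<close>

lemma scale_bezoutian_scale:
  assumes "\<sigma> \<in> V'" "\<And>p. \<sigma> (scale (Q * p) w) = 0" "scale Q v = 0"
  shows "scale (bezoutian Q \<sigma> (scale p w)) v = scale p (scale (bezoutian Q \<sigma> w) v)"
proof -
  obtain k where "bezoutian Q \<sigma> (scale p w) - p * bezoutian Q \<sigma> w = k * Q"
    using bezoutian_scale_mod[OF assms(1,2)] by (metis dvd_def mult.commute)
  then have "scale (bezoutian Q \<sigma> (scale p w) - p * bezoutian Q \<sigma> w) v = 0"
    using assms(3) by (simp flip: scale_scale)
  then show ?thesis by (simp add: scale_left_diff_distrib)
qed

text \<open>The same sum with the roles of the two variables of the Bezoutian exchanged.\<close>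

definition bezoutian_transpose :: "'a poly \<Rightarrow> ('v \<Rightarrow> 'a) \<Rightarrow> 'v \<Rightarrow> 'a poly" where
  "bezoutian_transpose Q \<rho> v = (\<Sum>k<degree Q. monom (\<rho> (scale (poly_shift (Suc k) Q) v)) k)"

lemma bezoutian_swap:
  assumes "\<sigma> \<in> V'" "\<rho> \<in> V'"
  shows "\<rho> (scale (bezoutian Q \<sigma> w) v) = \<sigma> (scale (bezoutian_transpose Q \<rho> v) w)"
proof -
  have "monom c k = smult c (monom 1 k)" for c :: 'a and k by (simp add: smult_monom)
  then have mono: "\<sigma> (scale (monom c k) w) = c * \<sigma> (scale (monom 1 k) w)" for c k
    using dual_smult[OF assms(1)] by metis
  have "\<rho> (scale (bezoutian Q \<sigma> w) v)
      = (\<Sum>k<degree Q. \<sigma> (scale (monom 1 k) w) * \<rho> (scale (poly_shift (Suc k) Q) v))"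
    unfolding bezoutian_def scale_sum_left dual_sum[OF assms(2)] dual_smult[OF assms(2)] ..
  also have "\<dots> = (\<Sum>k<degree Q. \<sigma> (scale (monom (\<rho> (scale (poly_shift (Suc k) Q) v)) k) w))"
    by (intro sum.cong refl, subst mono, rule mult.commute)
  also have "\<dots> = \<sigma> (scale (bezoutian_transpose Q \<rho> v) w)"
    unfolding bezoutian_transpose_def scale_sum_left dual_sum[OF assms(1)] ..
  finally show ?thesis .
qed

text \<open>
  The residue of \<open>p / Q\<close> at infinity, up to sign: a functional on \<open>R/Q\<close> whose pairing
  \<open>(p, p') \<mapsto> residue Q (p p')\<close> is nondegenerate and identifies \<open>R/Q\<close> with its dual. The two
  families \<open>t^k\<close> and \<open>poly_shift (Suc k) Q\<close> are dual bases for it, which is what the two lemmas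
  relating it to the Bezoutian express.
\<close>

definition residue :: "'a poly \<Rightarrow> 'a poly \<Rightarrow> 'a" where
  "residue Q p = coeff (p mod Q) (degree Q - 1) / lead_coeff Q"

lemma residue_dual: "residue Q \<in> dual ((*) :: 'a poly \<Rightarrow> 'a poly \<Rightarrow> 'a poly)"
  by (simp add: dual_poly_iff residue_def poly_mod_add_left mod_smult_left add_divide_distrib)

lemma residue_dvd: "Q dvd p \<Longrightarrow> residue Q p = 0"
  by (simp add: residue_def)

lemma bezoutian_residue_cyclic:
  assumes "degree Q > 0" "\<And>p. \<sigma> (scale p y) = residue Q p"
  shows "bezoutian Q \<sigma> y = 1"
proof -
  let ?d = "degree Q"
  have Q: "Q \<noteq> 0" using assms(1) by auto
  have "residue Q (monom 1 k) = (if k = ?d - 1 then 1 / lead_coeff Q else 0)" if "k < ?d" for k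
    using that by (simp add: residue_def mod_poly_less degree_monom_eq)
  then have "bezoutian Q \<sigma> y = (\<Sum>k<?d. if k = ?d - 1 then smult (1 / lead_coeff Q) (poly_shift (Suc k) Q) else 0)"
    unfolding bezoutian_def assms(2) by (intro sum.cong) auto
  also have "\<dots> = smult (1 / lead_coeff Q) (poly_shift ?d Q)"
    using assms(1) by (simp add: sum.delta)
  also have "\<dots> = 1" using Q by (simp add: poly_shift_degree one_pCons)
  finally show ?thesis .
qed

lemma residue_bezoutian:
  assumes "degree Q > 0"
  shows "residue Q (bezoutian Q \<rho> w) = \<rho> w"
proof -
  let ?d = "degree Q"
  have Q: "Q \<noteq> 0" using assms(1) by auto
  have deg: "degree (poly_shift (Suc k) Q) < ?d" for k
    using assms by (intro degree_lessI) (auto simp: coeff_poly_shift coeff_eq_0)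
  have "degree (bezoutian Q \<rho> w) \<le> ?d - 1"
    unfolding bezoutian_def
  proof (rule degree_sum_le)
    show "degree (smult (\<rho> (scale (monom 1 k) w)) (poly_shift (Suc k) Q)) \<le> ?d - 1" for k
      using degree_smult_le[of "\<rho> (scale (monom 1 k) w)" "poly_shift (Suc k) Q"] deg[of k] by linarith
  qed simp
  then have "bezoutian Q \<rho> w mod Q = bezoutian Q \<rho> w" using assms by (intro mod_poly_less) simp
  moreover have "coeff (bezoutian Q \<rho> w) (?d - 1) = \<rho> w * lead_coeff Q"
  proof -
    have "coeff (bezoutian Q \<rho> w) (?d - 1) = (\<Sum>k<?d. \<rho> (scale (monom 1 k) w) * coeff Q (?d + k))"
      using assms by (simp add: bezoutian_def coeff_sum coeff_poly_shift)
    also have "\<dots> = (\<Sum>k<?d. if k = 0 then \<rho> w * lead_coeff Q else 0)"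
      by (intro sum.cong) (auto simp: coeff_eq_0)
    also have "\<dots> = \<rho> w * lead_coeff Q" using assms by (simp add: sum.delta)
    finally show ?thesis .
  qed
  ultimately show ?thesis using Q by (simp add: residue_def)
qed

section \<open>Commutants of adjoints on torsion vectors\<close>

definition commutes_with_adjoints :: "(('v \<Rightarrow> 'a) \<Rightarrow> 'v \<Rightarrow> 'a) \<Rightarrow> bool" where
  "commutes_with_adjoints z \<longleftrightarrow>
    (\<forall>f. \<forall>\<rho>\<in>V'. module_hom scale scale f \<longrightarrow> z (\<rho> \<circ> f) = z \<rho> \<circ> f)"

definition acts_on_kernel :: "(('v \<Rightarrow> 'a) \<Rightarrow> 'v \<Rightarrow> 'a) \<Rightarrow> 'a poly \<Rightarrow> 'a poly \<Rightarrow> bool" where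
  "acts_on_kernel z q a \<longleftrightarrow> (\<forall>\<rho>\<in>V'. \<forall>v. scale q v = 0 \<longrightarrow> z \<rho> v = \<rho> (scale a v))"

lemma subspace_image: "subspace (range (scale q))"
  by (rule module_hom.subspace_image[OF scale_hom subspace_UNIV])

lemma subspace_kernel: "subspace {v. scale q v = 0}"
  by (rule module_hom.subspace_kernel[OF scale_hom])

lemma prime_power_generates_annihilator:
  assumes r: "comax_prime r" and W: "subspace W"
    and n: "scale (r ^ Suc n) y \<in> W" "scale (r ^ n) y \<notin> W" and p: "scale p y \<in> W"
  shows "r ^ Suc n dvd p"
proof (rule comax_prime_power_generates[OF r, of "{p. scale p y \<in> W}"])
  show "p * q \<in> {p. scale p y \<in> W}" if "q \<in> {p. scale p y \<in> W}" for p q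
    using subspace_scale[OF W, of "scale q y" p] that by simp
qed (use n p in \<open>auto simp: scale_left_distrib subspace_0[OF W] subspace_add[OF W]\<close>)

lemma degree_comax_prime_power: "comax_prime r \<Longrightarrow> degree (r ^ Suc n) > 0"
  by (metis comax_prime_def degree_power_eq mult_pos_pos zero_less_Suc degree_0 less_irrefl)

text \<open>The class of \<open>y\<close> generates a copy of \<open>R/Q\<close> in \<open>V/QV\<close>. The residue on this copy extends to a
  functional \<open>\<sigma>\<close> with \<open>Q \<sigma> = 0\<close>, and for each \<open>v \<in> V[Q]\<close> the Bezoutian of \<open>\<sigma>\<close> gives an endomorphism
  that sends \<open>y\<close> to \<open>v\<close>. Commuting \<open>z\<close> past it expresses \<open>(z \<rho>) v\<close> through \<open>z \<sigma>\<close> and \<open>y\<close>, which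
  do not depend on \<open>v\<close>.\<close>

lemma acts_on_kernel_cyclic_quotient:
  assumes z: "hom_on V' act V' act z" and comm: "commutes_with_adjoints z"
    and r: "comax_prime r" and y: "scale (r ^ n) y \<notin> range (scale (r ^ Suc n))"
  shows "\<exists>a. acts_on_kernel z (r ^ Suc n) a"
proof -
  define Q where Q_def: "Q = r ^ Suc n"
  have deg: "degree Q > 0" unfolding Q_def by (rule degree_comax_prime_power[OF r])
  have "residue Q p = 0" if "scale p y \<in> range (scale Q)" for p
    using prime_power_generates_annihilator[OF r subspace_image _ y] that unfolding Q_def
    by (intro residue_dvd) blast
  then obtain \<sigma> where \<sigma>: "\<sigma> \<in> V'" "\<And>p. \<sigma> (scale p y) = residue Q p"
      "\<And>w. w \<in> range (scale Q) \<Longrightarrow> \<sigma> w = 0"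
    using functional_on_cyclic[OF subspace_image residue_dual] by metis
  have \<sigma>0: "\<sigma> (scale (Q * p) w) = 0" for p w
    by (rule \<sigma>(3)) (metis rangeI scale_scale)
  have "z \<rho> v = \<rho> (scale (bezoutian Q (z \<sigma>) y) v)" if \<rho>: "\<rho> \<in> V'" and v: "scale Q v = 0" for \<rho> v
  proof -
    define e where "e w = scale (bezoutian Q \<sigma> w) v" for w
    have e: "module_hom scale scale e"
      unfolding module_hom_iff
      using module_axioms bezoutian_add[OF \<sigma>(1)] scale_bezoutian_scale[OF \<sigma>(1) \<sigma>0 v]
      by (simp add: e_def scale_left_distrib)
    have "\<rho> \<circ> e = act (bezoutian_transpose Q \<rho> v) \<sigma>"
      by (auto simp: e_def act_apply bezoutian_swap[OF \<sigma>(1) \<rho>])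
    then have "z (\<rho> \<circ> e) y = act (bezoutian_transpose Q \<rho> v) (z \<sigma>) y"
      using hom_onD(3)[OF z \<sigma>(1)] by simp
    also have "\<dots> = \<rho> (scale (bezoutian Q (z \<sigma>) y) v)"
      using bezoutian_swap[OF hom_onD(1)[OF z \<sigma>(1)] \<rho>] by (simp add: act_apply)
    also have "z (\<rho> \<circ> e) y = z \<rho> (e y)"
      using comm \<rho> e unfolding commutes_with_adjoints_def by simp
    also have "e y = v" using bezoutian_residue_cyclic[OF deg \<sigma>(2)] by (simp add: e_def)
    finally show ?thesis .
  qed
  then show ?thesis unfolding acts_on_kernel_def Q_def by blast
qed

lemma module_on_subspace: "subspace W \<Longrightarrow> module_on W scale"
  by (rule module_on.submodule[OF module_on_UNIV])
    (auto simp: subspace_0 subspace_add subspace_scale)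

text \<open>Here \<open>r^n V\<close> is \<open>r\<close>-divisible, so its \<open>r\<close>-primary part \<open>D\<close> is divisible and contains some \<open>x\<close> with
  annihilator exactly \<open>(Q)\<close>. The Bezoutian of a functional \<open>\<rho>\<close> maps \<open>V[Q]\<close> to \<open>R x\<close>, and injectivity of
  \<open>D\<close> extends this map to an endomorphism \<open>g\<close> of \<open>V\<close>. With \<open>\<epsilon>\<close> extending the residue on \<open>R x\<close>,
  the functionals \<open>\<epsilon> \<circ> g\<close> and \<open>\<rho>\<close> agree on \<open>V[Q]\<close>, so they differ by a multiple of \<open>Q\<close>, and
  \<open>(z \<rho>) v\<close> can be computed from \<open>z \<epsilon>\<close> on \<open>V[Q]\<close>.\<close>

lemma acts_on_kernel_divisible:
  assumes z: "hom_on V' act V' act z" and comm: "commutes_with_adjoints z"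
    and r: "comax_prime r"
    and im: "range (scale (r ^ n)) \<subseteq> range (scale (r ^ Suc n))"
    and x0: "scale r (scale (r ^ n) u) = 0" "scale (r ^ n) u \<noteq> 0"
  shows "\<exists>a. acts_on_kernel z (r ^ Suc n) a"
proof -
  define Q where Q_def: "Q = r ^ Suc n"
  define W where "W = range (scale (r ^ n))"
  have W: "subspace W" unfolding W_def by (rule subspace_image)
  have Wdiv: "\<exists>y\<in>W. scale (r ^ k) y = x" if "x \<in> W" for x k
    using that
  proof (induction k arbitrary: x)
    case (Suc k)
    then obtain y where "x = scale (r ^ Suc n) y" using im unfolding W_def by blast
    then have x: "x = scale r (scale (r ^ n) y)" by simp
    obtain w where "w \<in> W" "scale (r ^ k) w = scale (r ^ n) y" using Suc.IH W_def by blast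
    then show ?case using x by (metis power_Suc scale_scale)
  qed auto
  define D where "D = {w \<in> W. \<exists>k. scale (r ^ k) w = 0}"
  have up: "scale (r ^ k) w = 0" if "scale (r ^ j) w = 0" "j \<le> k" for w j k
  proof -
    have "r ^ k = r ^ (k - j) * r ^ j" using that(2) by (simp flip: power_add)
    then show ?thesis using that(1) by (metis scale_scale scale_zero_right)
  qed
  have "subspace D"
  proof (rule subspaceI)
    show "0 \<in> D" by (simp add: D_def subspace_0[OF W])
    show "x + y \<in> D" if xy: "x \<in> D" "y \<in> D" for x y
    proof -
      obtain j k where "scale (r ^ j) x = 0" "scale (r ^ k) y = 0" using xy D_def by blast
      then have "scale (r ^ (max j k)) (x + y) = 0"
        by (simp add: scale_right_distrib up[of j x] up[of k y])
      then show ?thesis using xy subspace_add[OF W] unfolding D_def by blast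
    qed
    show "scale c x \<in> D" if "x \<in> D" for c x
      using that subspace_scale[OF W] unfolding D_def
      by (smt (verit, best) mem_Collect_eq scale_left_commute scale_zero_right)
  qed
  then have D: "module_on D scale" by (rule module_on_subspace)
  have div: "\<exists>y\<in>D. scale q y = x" if q: "q \<noteq> 0" and x: "x \<in> D" for q x
  proof -
    obtain j g where q': "q = r ^ j * g" and g: "comaximal r g"
      using comax_prime_split[OF r q] by blast
    obtain k where k: "scale (r ^ k) x = 0" and xW: "x \<in> W" using x D_def by blast
    obtain a b where ab: "a * r ^ k + b * g = 1"
      using comaximal_power_left[OF g, of k] unfolding comaximal_def by blast
    obtain y where y: "y \<in> W" "scale (r ^ j) y = scale b x"
      using Wdiv subspace_scale[OF W xW] by blast
    have "scale (r ^ k) (scale (r ^ j) y) = scale b (scale (r ^ k) x)"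
      unfolding y(2) by (rule scale_left_commute)
    then have "scale (r ^ (k + j)) y = 0" using k by (simp add: power_add)
    then have "y \<in> D" using y(1) D_def by blast
    moreover have "scale q y = x"
    proof -
      have "scale q y = scale g (scale (r ^ j) y)" by (simp add: q' mult.commute)
      also have "\<dots> = scale (a * r ^ k + b * g) x"
        using k scale_left_commute[of g b x] unfolding y(2)
        by (simp add: scale_left_distrib flip: scale_scale)
      finally show ?thesis by (simp add: ab)
    qed
    ultimately show ?thesis by blast
  qed
  obtain x where xW: "x \<in> W" and x: "scale (r ^ n) x = scale (r ^ n) u"
    using Wdiv[of "scale (r ^ n) u" n] W_def by blast
  have Qx: "scale Q x = 0" using x x0(1) unfolding Q_def by (metis power_Suc scale_scale)
  have xD: "x \<in> D" using xW Qx unfolding D_def Q_def by blast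
  have deg: "degree Q > 0" unfolding Q_def by (rule degree_comax_prime_power[OF r])
  have "residue Q p = 0" if "scale p x \<in> {0}" for p
    using prime_power_generates_annihilator[OF r subspace_single_0 _ _ that, of n] Qx x x0(2)
    by (intro residue_dvd) (simp add: Q_def)
  then obtain \<epsilon> where \<epsilon>: "\<epsilon> \<in> V'" "\<And>p. \<epsilon> (scale p x) = residue Q p"
    using functional_on_cyclic[OF subspace_single_0 residue_dual] by metis
  have "z \<rho> v = \<rho> (scale (bezoutian_transpose Q (z \<epsilon>) x) v)" if \<rho>: "\<rho> \<in> V'" and v: "scale Q v = 0" for \<rho> v
  proof -
    define f where "f w = scale (bezoutian Q \<rho> w) x" for w
    have f: "hom_on {w. scale Q w = 0} scale D scale f"
    proof (rule hom_onI)
      show "f w \<in> D" for w unfolding f_def using module_on.scale_mem[OF D xD] .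
      show "f (w + w') = f w + f w'" for w w'
        by (simp add: f_def bezoutian_add[OF \<rho>] scale_left_distrib)
      show "f (scale p w) = scale p (f w)" if w: "w \<in> {w. scale Q w = 0}" for p w
        unfolding f_def
      proof (rule scale_bezoutian_scale[OF \<rho> _ Qx])
        fix p
        have "scale (Q * p) w = scale p (scale Q w)" by (simp only: scale_scale mult.commute)
        also have "scale Q w = 0" using w by blast
        finally show "\<rho> (scale (Q * p) w) = 0" using \<rho> by (simp only: scale_zero_right dual_zero)
      qed
    qed
    obtain g where g: "hom_on UNIV scale D scale g"
        and gf: "\<And>w. scale Q w = 0 \<Longrightarrow> g w = f w"
      using divisible_extension[OF module_on_UNIV D div module_on_subspace[OF subspace_kernel]
            subset_UNIV f] by auto
    have gh: "module_hom scale scale g"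
      using g module_axioms unfolding module_hom_iff hom_on_def by blast
    have \<epsilon>g: "\<epsilon> \<circ> g \<in> V'" by (rule dual_comp_hom[OF \<epsilon>(1) gh])
    have "(\<rho> - (\<epsilon> \<circ> g)) w = 0" if "scale Q w = 0" for w
      using gf[OF that] residue_bezoutian[OF deg, of \<rho> w] by (simp add: f_def \<epsilon>(2))
    then obtain \<sigma> where \<sigma>: "\<sigma> \<in> V'" "\<rho> - (\<epsilon> \<circ> g) = act Q \<sigma>"
      using vanishing_on_kernel[OF dual_diff_mem[OF \<rho> \<epsilon>g]] by metis
    have a\<sigma>: "act Q \<sigma> \<in> V'" using module_on.scale_mem[OF module_on_dual \<sigma>(1)] .
    have "\<rho> = (\<epsilon> \<circ> g) + act Q \<sigma>" using \<sigma>(2) by (metis add_diff_cancel_left' add.commute diff_add_cancel)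
    then have "z \<rho> = z (\<epsilon> \<circ> g) + act Q (z \<sigma>)"
      using hom_onD(2)[OF z \<epsilon>g a\<sigma>] hom_onD(3)[OF z \<sigma>(1)] by simp
    then have "z \<rho> v = z (\<epsilon> \<circ> g) v"
      using v hom_onD(1)[OF z \<sigma>(1)] by (simp add: act_apply)
    also have "\<dots> = z \<epsilon> (g v)"
      using comm \<epsilon>(1) gh unfolding commutes_with_adjoints_def by simp
    also have "\<dots> = \<rho> (scale (bezoutian_transpose Q (z \<epsilon>) x) v)"
      using bezoutian_swap[OF \<rho> hom_onD(1)[OF z \<epsilon>(1)], of Q v x] by (simp add: gf[OF v] f_def)
    finally show ?thesis .
  qed
  then show ?thesis unfolding acts_on_kernel_def Q_def by blast
qed

text \<open>Induction on the degree of \<open>q\<close>. A product of coprime factors is handled by the Chinese remainder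
  theorem. For a prime power \<open>r^(m+1)\<close> there remains, besides the two preceding lemmas, the case
  that \<open>r^m V\<close> has no \<open>r\<close>-torsion; then \<open>V[r^(m+1)] = V[r^m]\<close>.\<close>

lemma acts_on_kernel_exists:
  assumes z: "hom_on V' act V' act z" and comm: "commutes_with_adjoints z" and q: "q \<noteq> 0"
  shows "\<exists>a. acts_on_kernel z q a"
  using q
proof (induction "degree q" arbitrary: q rule: less_induct)
  case less
  show ?case
  proof (cases "degree q = 0")
    case True
    then have "q dvd 1" using less.prems by (simp add: is_unit_iff_degree)
    then obtain h where "1 = h * q" by (metis dvd_def mult.commute)
    then have "v = 0" if "scale q v = 0" for v
      using that by (metis scale_one scale_scale scale_zero_right)
    then have "acts_on_kernel z q 0"
      using hom_onD(1)[OF z] unfolding acts_on_kernel_def by fastforce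
    then show ?thesis by blast
  next
    case False
    then obtain r where r: "comax_prime r" and "r dvd q"
      using comax_prime_divisor[OF less.prems] by blast
    obtain n u where q: "q = r ^ n * u" and u: "comaximal r u"
      using comax_prime_split[OF r less.prems] by blast
    have nz: "r \<noteq> 0" "u \<noteq> 0" using less.prems q r by (auto simp: comax_prime_def)
    have dq: "degree q = n * degree r + degree u"
      using nz by (simp add: q degree_mult_eq degree_power_eq)
    obtain a b where ab: "a * r ^ n + b * u = 1"
      using comaximal_power_left[OF u, of n] unfolding comaximal_def by blast
    have "n \<noteq> 0"
    proof
      assume "n = 0"
      then have "r dvd u" using \<open>r dvd q\<close> q by simp
      then have "r dvd 1" using u unfolding comaximal_def
        by (metis dvd_add dvd_refl dvd_mult)
      then show False using r nz by (simp add: is_unit_iff_degree comax_prime_def)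
    qed
    then obtain m where n: "n = Suc m" by (cases n) auto
    have r0: "degree r > 0" using r by (simp add: comax_prime_def)
    show ?thesis
    proof (cases "degree u = 0")
      case False
      then have "degree (r ^ n) < degree q" "degree u < degree q"
        using False dq nz r0 n by (simp_all add: degree_power_eq del: power_Suc)
      then obtain c d where c: "acts_on_kernel z (r ^ n) c" and d: "acts_on_kernel z u d"
        using less.hyps nz by (metis power_not_zero)
      have "acts_on_kernel z q (c * (b * u) + d * (a * r ^ n))"
        unfolding acts_on_kernel_def
      proof (intro ballI allI impI)
        fix \<rho> v assume \<rho>: "\<rho> \<in> V'" and v: "scale q v = 0"
        have zr: "z \<rho> \<in> V'" by (rule hom_onD(1)[OF z \<rho>])
        have "scale (r ^ n) (scale (b * u) v) = scale b (scale q v)"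
          by (simp add: q mult_ac)
        then have 1: "scale (r ^ n) (scale (b * u) v) = 0" using v by simp
        have "scale u (scale (a * r ^ n) v) = scale a (scale q v)"
          by (simp add: q mult_ac)
        then have 2: "scale u (scale (a * r ^ n) v) = 0" using v by simp
        have "v = scale (b * u) v + scale (a * r ^ n) v"
          using ab by (metis add.commute scale_left_distrib scale_one)
        then have "z \<rho> v = z \<rho> (scale (b * u) v) + z \<rho> (scale (a * r ^ n) v)"
          using dual_add[OF zr] by metis
        also have "\<dots> = \<rho> (scale c (scale (b * u) v)) + \<rho> (scale d (scale (a * r ^ n) v))"
          using c d 1 2 \<rho> unfolding acts_on_kernel_def by metis
        also have "\<dots> = \<rho> (scale (c * (b * u) + d * (a * r ^ n)) v)"
          by (simp add: scale_left_distrib dual_add[OF \<rho>])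
        finally show "z \<rho> v = \<rho> (scale (c * (b * u) + d * (a * r ^ n)) v)" .
      qed
      then show ?thesis by blast
    next
      case True
      have "u dvd 1" using True nz by (simp add: is_unit_iff_degree)
      then obtain h where h: "1 = h * u" by (metis dvd_def mult.commute)
      have ker: "scale (r ^ n) v = 0" if "scale q v = 0" for v
      proof -
        have "scale (r ^ n) v = scale (h * u) (scale (r ^ n) v)" using h by simp
        also have "\<dots> = scale h (scale q v)" by (simp add: q mult_ac)
        finally show ?thesis using that by simp
      qed
      have "\<exists>a. acts_on_kernel z (r ^ n) a"
      proof (cases "range (scale (r ^ m)) \<subseteq> range (scale (r ^ Suc m))")
        case im: True
        show ?thesis
        proof (cases "\<exists>y. scale r (scale (r ^ m) y) = 0 \<and> scale (r ^ m) y \<noteq> 0")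
          case True
          then show ?thesis using acts_on_kernel_divisible[OF z comm r im] n by blast
        next
          case False
          have "degree (r ^ m) < degree q" using dq nz n r0 by (simp add: degree_power_eq)
          then obtain a where a: "acts_on_kernel z (r ^ m) a" using less.hyps nz by (metis power_not_zero)
          have "acts_on_kernel z (r ^ n) a"
            using a False unfolding acts_on_kernel_def n by simp
          then show ?thesis by blast
        qed
      next
        case False
        then obtain y where "scale (r ^ m) y \<notin> range (scale (r ^ Suc m))" by blast
        then show ?thesis using acts_on_kernel_cyclic_quotient[OF z comm r] n by blast
      qed
      then show ?thesis using ker unfolding acts_on_kernel_def by metis
    qed
  qed
qed

section \<open>Functionals that are not torsion\<close>

text \<open>A gliding hump. If \<open>L\<close> is unbounded, there are \<open>s\<^sub>0 | s\<^sub>1 | ...\<close> and \<open>x\<^sub>k \<in> L\<close> with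
  \<open>s\<^sub>k\<^sup>2 x\<^sub>k \<noteq> 0\<close> and \<open>s\<^sub>k\<^sub>+\<^sub>1 x\<^sub>k = 0\<close>. The vectors \<open>w\<^sub>k = s\<^sub>k x\<^sub>k\<close> are linearly independent, since the
  earlier ones are killed by \<open>s\<^sub>k\<close> while \<open>w\<^sub>k\<close> is not, so some functional takes the value \<open>1\<close> on all
  of them. If \<open>s\<close> kills that functional on \<open>L\<close>, the gcds of \<open>s\<close> and \<open>s\<^sub>k\<close> have strictly increasing
  degrees, although they divide \<open>s\<close>.\<close>

lemma bounded_if_dual_torsion:
  assumes L: "subspace L" and tors: "\<And>x. x \<in> L \<Longrightarrow> \<exists>p. p \<noteq> 0 \<and> scale p x = 0"
    and dual: "\<And>\<rho>. \<rho> \<in> V' \<Longrightarrow> \<exists>s. s \<noteq> 0 \<and> (\<forall>x\<in>L. \<rho> (scale s x) = 0)"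
  shows "\<exists>s. s \<noteq> 0 \<and> (\<forall>x\<in>L. scale s x = 0)"
proof (rule ccontr)
  assume unb: "\<not> ?thesis"
  define X where "X s = (SOME x. x \<in> L \<and> scale (s * s) x \<noteq> 0)" for s
  define A where "A s = (SOME p. p \<noteq> 0 \<and> scale p (X s) = 0)" for s
  define S where "S = rec_nat (1 :: 'a poly) (\<lambda>_ s. s * A s)"
  define x where "x k = X (S k)" for k
  define w where "w k = scale (S k) (x k)" for k
  have X: "X s \<in> L \<and> scale (s * s) (X s) \<noteq> 0" if "s \<noteq> 0" for s
  proof -
    have "s * s \<noteq> 0" using that by simp
    then have "\<exists>x. x \<in> L \<and> scale (s * s) x \<noteq> 0" using unb by blast
    then show ?thesis unfolding X_def by (rule someI_ex)
  qed
  have A: "A s \<noteq> 0 \<and> scale (A s) (X s) = 0" if "s \<noteq> 0" for s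
    unfolding A_def by (rule someI_ex) (use tors X[OF that] in blast)
  have S_Suc: "S (Suc k) = S k * A (S k)" for k by (simp add: S_def)
  have S0: "S k \<noteq> 0" for k
  proof (induction k)
    case (Suc k)
    then show ?case using A[of "S k"] by (simp add: S_Suc)
  qed (simp add: S_def)
  have x: "x k \<in> L" "scale (S k) (w k) \<noteq> 0" "scale (S (Suc k)) (x k) = 0" for k
  proof -
    show "x k \<in> L" "scale (S k) (w k) \<noteq> 0" using X[OF S0[of k]] by (auto simp: x_def w_def)
    have "scale (S (Suc k)) (x k) = scale (S k) (scale (A (S k)) (x k))" by (simp add: S_Suc)
    then show "scale (S (Suc k)) (x k) = 0" using A[OF S0[of k]] by (simp add: x_def)
  qed
  have S_dvd: "S j dvd S k" if "j \<le> k" for j k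
    using that by (induction rule: dec_induct) (auto simp: S_Suc)
  have w_ker: "scale (S k) (w j) = 0" if "j < k" for j k
  proof -
    have "S (Suc j) dvd S k" using that by (intro S_dvd) simp
    then obtain h where "S k = S (Suc j) * h" by blast
    then have "scale (S k) (w j) = scale (h * S j) (scale (S (Suc j)) (x j))"
      by (simp add: w_def mult_ac)
    then show ?thesis using x(3) by simp
  qed
  interpret F: vector_space "field_scale scale" by (rule field_scale_vector_space)
  interpret K: vector_space "(*) :: 'a \<Rightarrow> 'a \<Rightarrow> 'a" by unfold_locales (auto simp: algebra_simps)
  interpret FK: vector_space_pair "field_scale scale" "(*) :: 'a \<Rightarrow> 'a \<Rightarrow> 'a" ..
  have indep: "F.independent (w ` {..<k})" for k
  proof (induction k)
    case (Suc k)
    have "F.span (w ` {..<k}) \<subseteq> {v. scale (S k) v = 0}"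
    proof (rule F.span_minimal)
      show "F.subspace {v. scale (S k) v = 0}"
        using subspace_kernel[of "S k"] unfolding F.subspace_def subspace_def field_scale_def by blast
    qed (use w_ker in auto)
    then have "w k \<notin> F.span (w ` {..<k})" using x(2) by blast
    then show ?case using Suc by (simp add: lessThan_Suc F.independent_insertI)
  qed (simp add: F.independent_empty)
  have "range w = \<Union> (range (\<lambda>k. w ` {..<k}))" by blast
  moreover have "F.independent (\<Union> (range (\<lambda>k. w ` {..<k})))"
  proof (rule F.independent_Union_directed)
    show "c \<subseteq> d \<or> d \<subseteq> c" if "c \<in> range (\<lambda>k. w ` {..<k})" "d \<in> range (\<lambda>k. w ` {..<k})" for c d
    proof -
      from that obtain i j where "c = w ` {..<i}" "d = w ` {..<j}" by blast
      then show ?thesis by (cases "i \<le> j") (auto intro!: image_mono)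
    qed
  qed (use indep in blast)
  ultimately have "F.independent (range w)" by simp
  then obtain \<theta> where "Vector_Spaces.linear (field_scale scale) (*) \<theta>" and \<theta>w: "\<And>k. \<theta> (w k) = 1"
    using FK.linear_independent_extend[of "range w" "\<lambda>_. 1"] by auto
  then have \<theta>: "\<theta> \<in> V'" by (simp add: dual_def)
  obtain s where s: "s \<noteq> 0" "\<And>x. x \<in> L \<Longrightarrow> \<theta> (scale s x) = 0" using dual[OF \<theta>] by blast
  have "\<exists>g a b. g = a * s + b * S k \<and> g dvd s \<and> g dvd S k" for k
    using poly_bezout[of s "S k"] by metis
  then obtain g a b where g: "\<And>k. g k = a k * s + b k * S k" "\<And>k. g k dvd s" "\<And>k. g k dvd S k"
    by metis
  have step: "degree (g k) < degree (g (Suc k))" for k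
  proof (rule ccontr)
    assume "\<not> ?thesis"
    moreover have "S k dvd S (Suc k)" by (rule S_dvd) simp
    then have "g k dvd g (Suc k)" using g(2,3)[of k] unfolding g(1)[of "Suc k"]
      by (meson dvd_add dvd_mult dvd_trans)
    moreover have "g (Suc k) \<noteq> 0" using g(2)[of "Suc k"] s(1) by auto
    ultimately have "g (Suc k) dvd g k" using poly_dvd_antisym_degree not_less by blast
    then have "g (Suc k) dvd S k" using g(3)[of k] by (rule dvd_trans)
    then obtain h where "S k = g (Suc k) * h" by blast
    then have "S k = s * (h * a (Suc k)) + (h * b (Suc k)) * S (Suc k)"
      unfolding g(1) by (simp add: algebra_simps)
    then have "w k = scale s (scale (h * a (Suc k)) (x k)) + scale (h * b (Suc k)) (scale (S (Suc k)) (x k))"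
      unfolding w_def by (simp only: scale_left_distrib scale_scale)
    moreover have "\<theta> (scale s (scale (h * a (Suc k)) (x k))) = 0"
      using s(2) subspace_scale[OF L x(1)] by blast
    ultimately have "\<theta> (w k) = 0" using x(3)[of k] by (simp add: dual_add[OF \<theta>])
    then show False using \<theta>w by simp
  qed
  have "k \<le> degree (g k)" for k
    by (induction k) (use step in \<open>auto intro: le_less_trans simp: Suc_le_eq\<close>)
  moreover have "degree (g k) \<le> degree s" for k
    by (rule dvd_imp_degree_le[OF g(2) s(1)])
  ultimately show False using not_less_eq_eq le_trans by blast
qed

text \<open>A functional on the polynomial ring is a sequence of field elements, and it is torsion if the
  sequence satisfies a linear recurrence. The indicator sequence of the powers of two does not,
  because its gaps grow.\<close>

lemma dual_poly_nontorsion: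
  obtains \<delta> where "\<delta> \<in> dual ((*) :: 'a poly \<Rightarrow> 'a poly \<Rightarrow> 'a poly)"
    "\<And>s. s \<noteq> 0 \<Longrightarrow> \<exists>p. \<delta> (p * s) \<noteq> 0"
proof -
  define \<chi> where "\<chi> i = (if \<exists>j. i = 2 ^ j then 1 else 0 :: 'a)" for i :: nat
  define \<delta> where "\<delta> p = (\<Sum>i\<le>degree p. coeff p i * \<chi> i)" for p :: "'a poly"
  have \<delta>: "\<delta> p = (\<Sum>i\<le>N. coeff p i * \<chi> i)" if "degree p \<le> N" for p N
    unfolding \<delta>_def using that by (intro sum.mono_neutral_left) (auto simp: coeff_eq_0)
  have add: "\<delta> (p + q) = \<delta> p + \<delta> q" for p q
  proof -
    define N where "N = max (degree p) (degree q)"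
    have "degree p \<le> N" "degree q \<le> N" "degree (p + q) \<le> N"
      by (auto simp: N_def degree_add_le)
    then show ?thesis by (simp add: \<delta>[of _ N] sum.distrib algebra_simps)
  qed
  have smult: "\<delta> (smult c p) = c * \<delta> p" for c p
    using \<delta>[of "smult c p" "degree p"] by (simp add: \<delta>_def sum_distrib_left mult.assoc)
  have "\<delta> (monom 1 (2 ^ Suc (degree s) - degree s) * s) \<noteq> 0" if s: "s \<noteq> 0" for s
  proof -
    define d where "d = degree s"
    \<comment> \<open>The exponents occurring in \<open>t^m s\<close> lie in an interval of length \<open>d\<close> ending at a power of two;
      as \<open>d < 2 ^ d\<close>, its right end point is the only power of two in it.\<close>
    define m where "m = 2 ^ Suc d - d"
    have d: "d < 2 ^ d" by (rule less_exp)
    then have md: "m + d = 2 ^ Suc d" and m: "2 ^ d < m" unfolding m_def power_Suc by linarith+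
    have "coeff (monom 1 m * s) i * \<chi> i = (if i = m + d then lead_coeff s else 0)" if i: "i \<le> m + d" for i
    proof (cases "i < m")
      case False
      have "i = m + d" if "i = 2 ^ j" for j
      proof -
        have "(2::nat) ^ d < 2 ^ j" "(2::nat) ^ j \<le> 2 ^ Suc d" using False m i md that by linarith+
        then have "d < j" "j \<le> Suc d"
          using power_less_imp_less_exp[of 2 d j] power_le_imp_le_exp[of 2 j "Suc d"] by simp_all
        then have "j = Suc d" by simp
        then show ?thesis using that md by simp
      qed
      then have "\<chi> i = 0" if "i \<noteq> m + d" using that by (auto simp: \<chi>_def)
      moreover have "\<chi> (m + d) = 1" unfolding \<chi>_def md by (metis (mono_tags))
      ultimately show ?thesis by (auto simp: coeff_monom_mult d_def)
    qed (auto simp: coeff_monom_mult)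
    then have "(\<Sum>i\<le>m + d. coeff (monom 1 m * s) i * \<chi> i) = lead_coeff s" by (simp add: sum.delta)
    moreover have "degree (monom 1 m * s) \<le> m + d"
      using degree_mult_le[of "monom 1 m" s] by (simp add: d_def degree_monom_eq)
    ultimately show ?thesis using s \<delta>[of "monom 1 m * s" "m + d"] by (simp add: m_def d_def)
  qed
  then show ?thesis using that[of \<delta>] add smult by (auto simp: dual_poly_iff)
qed

section \<open>The annihilator of the torsion submodule\<close>

definition tors :: "'v set" where
  "tors = {v. \<exists>p. p \<noteq> 0 \<and> scale p v = 0}"

lemma subspace_tors: "subspace tors"
proof (rule subspaceI)
  show "0 \<in> tors" by (auto simp: tors_def intro: exI[of _ 1])
  show "x + y \<in> tors" if "x \<in> tors" "y \<in> tors" for x y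
  proof -
    obtain p q where pq: "p \<noteq> 0" "scale p x = 0" "q \<noteq> 0" "scale q y = 0" using \<open>x \<in> tors\<close> \<open>y \<in> tors\<close> tors_def by blast
    have "scale (p * q) (x + y) = scale q (scale p x) + scale p (scale q y)"
      by (simp add: scale_right_distrib mult.commute)
    then have "p * q \<noteq> 0" "scale (p * q) (x + y) = 0"
      by (simp_all add: pq)
    then show ?thesis unfolding tors_def by blast
  qed
  show "scale c x \<in> tors" if "x \<in> tors" for c x
    using that unfolding tors_def by (smt (verit) mem_Collect_eq scale_left_commute scale_zero_right)
qed

lemma tors_scale_cancel:
  assumes "q \<noteq> 0" "scale q v \<in> tors"
  shows "v \<in> tors"
proof -
  obtain p where "p \<noteq> 0" "scale p (scale q v) = 0" using assms(2) tors_def by blast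
  then have "p * q \<noteq> 0" "scale (p * q) v = 0" using assms(1) by auto
  then show ?thesis unfolding tors_def by blast
qed

definition tors_perp :: "('v \<Rightarrow> 'a) set" where
  "tors_perp = {\<rho> \<in> V'. \<forall>v\<in>tors. \<rho> v = 0}"

lemma tors_perp_subset: "tors_perp \<subseteq> V'"
  unfolding tors_perp_def by blast

lemma module_on_tors_perp: "module_on tors_perp act"
proof (rule module_on.submodule[OF module_on_dual tors_perp_subset])
  show "0 \<in> tors_perp"
    using module_on.zero_mem[OF module_on_dual] by (simp add: tors_perp_def)
  show "\<rho> + \<sigma> \<in> tors_perp" if "\<rho> \<in> tors_perp" "\<sigma> \<in> tors_perp" for \<rho> \<sigma>
    using that module_on.add_mem[OF module_on_dual] by (simp add: tors_perp_def)
  show "act p \<rho> \<in> tors_perp" if "\<rho> \<in> tors_perp" for p \<rho>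
    using that module_on.scale_mem[OF module_on_dual] subspace_scale[OF subspace_tors]
    by (simp add: tors_perp_def act_apply)
qed

text \<open>To divide \<open>\<delta>\<close> by \<open>q\<close>, prescribe \<open>q v \<mapsto> \<delta> v\<close> and the value \<open>0\<close> on the torsion submodule. This is
  consistent because \<open>q v\<close> is torsion only if \<open>v\<close> is.\<close>

lemma tors_perp_divisible:
  assumes q: "q \<noteq> 0" and \<delta>: "\<delta> \<in> tors_perp"
  shows "\<exists>\<rho>\<in>tors_perp. act q \<rho> = \<delta>"
proof -
  have "\<delta> v = 0" if "scale q v \<in> tors" for v
    using tors_scale_cancel[OF q that] \<delta> unfolding tors_perp_def by blast
  moreover have "\<delta> \<in> V'" using \<delta> tors_perp_subset by blast
  ultimately obtain \<rho> where "\<rho> \<in> V'" "\<And>v. \<rho> (scale q v) = \<delta> v" "\<And>w. w \<in> tors \<Longrightarrow> \<rho> w = 0"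
    using functional_extension[OF module_axioms scale_hom[of q] subspace_tors, of \<delta>] by blast
  then show ?thesis unfolding tors_perp_def by (intro bexI[of _ \<rho>]) (auto simp: act_apply)
qed

text \<open>The functionals in the annihilator of the torsion submodule \<open>T\<close> that are killed by \<open>s\<close> are those
  that vanish on \<open>T + s V\<close>.\<close>

lemma tors_perp_kernel_trivial:
  assumes "\<And>\<delta>. \<delta> \<in> tors_perp \<Longrightarrow> act s \<delta> = 0 \<Longrightarrow> \<delta> = 0"
  obtains \<tau> w where "\<tau> \<in> tors" "v = \<tau> + scale s w"
proof -
  define W where "W = {x + y | x y. x \<in> tors \<and> y \<in> range (scale s)}"
  note T = subspace_0[OF subspace_tors] subspace_add[OF subspace_tors] subspace_scale[OF subspace_tors]
  note I = subspace_0[OF subspace_image] subspace_add[OF subspace_image] subspace_scale[OF subspace_image]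
  have mem: "x + y \<in> W" if "x \<in> tors" "y \<in> range (scale s)" for x y
    using that unfolding W_def by blast
  have W: "subspace W"
  proof (rule subspaceI)
    show "0 \<in> W" using mem[OF T(1) I(1)] by simp
    show "u + v \<in> W" if uv: "u \<in> W" "v \<in> W" for u v
    proof -
      obtain x y x' y' where "u = x + y" "x \<in> tors" "y \<in> range (scale s)"
        "v = x' + y'" "x' \<in> tors" "y' \<in> range (scale s)"
        using uv unfolding W_def by blast
      moreover from this have "u + v = (x + x') + (y + y')" by (simp add: algebra_simps)
      ultimately show ?thesis using mem[OF T(2) I(2)] by metis
    qed
    show "scale c u \<in> W" if u: "u \<in> W" for c u
    proof -
      obtain x y where "u = x + y" "x \<in> tors" "y \<in> range (scale s)" using u unfolding W_def by blast
      then show ?thesis using mem[OF T(3) I(3)] by (simp only: scale_right_distrib)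
    qed
  qed
  have "v \<in> W"
  proof (rule ccontr)
    assume "v \<notin> W"
    then obtain \<rho> where \<rho>: "\<rho> \<in> V'" "\<rho> v \<noteq> 0" "\<And>w. w \<in> W \<Longrightarrow> \<rho> w = 0"
      using separation[OF W] by metis
    have "\<tau> + 0 \<in> W" if "\<tau> \<in> tors" for \<tau>
      using that subspace_0[OF subspace_image] unfolding W_def by blast
    then have "\<rho> \<in> tors_perp" using \<rho> unfolding tors_perp_def by simp
    moreover have "0 + scale s x \<in> W" for x
      using subspace_0[OF subspace_tors] unfolding W_def by blast
    then have "act s \<rho> = 0" using \<rho>(3) by (auto simp: act_apply)
    ultimately show False using assms \<rho>(2) by fastforce
  qed
  then show ?thesis using that unfolding W_def by blast
qed

lemma tors_perp_nontorsion:
  assumes "\<xi> \<notin> tors"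
  obtains \<delta> where "\<delta> \<in> tors_perp" "\<And>s. s \<noteq> 0 \<Longrightarrow> act s \<delta> \<noteq> 0"
proof -
  obtain \<delta> where \<delta>: "\<delta> \<in> dual ((*) :: 'a poly \<Rightarrow> 'a poly \<Rightarrow> 'a poly)"
      "\<And>s. s \<noteq> 0 \<Longrightarrow> \<exists>p. \<delta> (p * s) \<noteq> 0"
    by (rule dual_poly_nontorsion) blast
  have "\<delta> 0 = 0" using \<delta>(1)[unfolded dual_poly_iff] by (metis mult_zero_left smult_0_left)
  then have "\<delta> p = 0" if "scale p \<xi> \<in> tors" for p
    using tors_scale_cancel[OF _ that] assms by (cases "p = 0") auto
  then obtain \<rho> where \<rho>: "\<rho> \<in> V'" "\<And>p. \<rho> (scale p \<xi>) = \<delta> p" "\<And>w. w \<in> tors \<Longrightarrow> \<rho> w = 0"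
    using functional_on_cyclic[OF subspace_tors \<delta>(1)] by metis
  have "act s \<rho> \<noteq> 0" if s: "s \<noteq> 0" for s
  proof
    assume 0: "act s \<rho> = 0"
    obtain p where p: "\<delta> (p * s) \<noteq> 0" using \<delta>(2)[OF s] by blast
    have "act s \<rho> (scale p \<xi>) = \<delta> (p * s)" using \<rho>(2) by (simp add: act_apply mult.commute)
    then show False using 0 p by simp
  qed
  then show ?thesis using that[of \<rho>] \<rho> unfolding tors_perp_def by blast
qed

section \<open>Central operators on the dual\<close>

lemma adjoint_hom_on:
  assumes "module_hom scale scale f"
  shows "hom_on V' act V' act (\<lambda>\<rho>. \<rho> \<circ> f)"
  using assms by (intro hom_onI dual_comp_hom) (auto simp: act_apply module_hom.scale)

lemma commutes_with_adjointsI: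
  assumes "\<And>g \<rho>. hom_on V' act V' act g \<Longrightarrow> \<rho> \<in> V' \<Longrightarrow> z (g \<rho>) = g (z \<rho>)"
  shows "commutes_with_adjoints z"
  using assms[OF adjoint_hom_on] unfolding commutes_with_adjoints_def by blast

lemma central_pointwise_torsion:
  assumes z: "hom_on V' act V' act z" and comm: "commutes_with_adjoints z" and \<tau>: "\<tau> \<in> tors"
  obtains \<zeta> where "\<zeta> \<in> tors" "\<And>\<rho>. \<rho> \<in> V' \<Longrightarrow> z \<rho> \<tau> = \<rho> \<zeta>"
proof -
  obtain q where q: "q \<noteq> 0" "scale q \<tau> = 0" using \<tau> unfolding tors_def by blast
  obtain a where "acts_on_kernel z q a" using acts_on_kernel_exists[OF z comm q(1)] by blast
  then have "z \<rho> \<tau> = \<rho> (scale a \<tau>)" if "\<rho> \<in> V'" for \<rho>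
    using q(2) that unfolding acts_on_kernel_def by blast
  then show ?thesis using that subspace_scale[OF subspace_tors \<tau>] by blast
qed

lemma hom_into_tors_perp:
  assumes "\<rho> \<in> V'" "\<delta> \<in> tors_perp" "\<And>p. act p \<rho> = 0 \<Longrightarrow> act p \<delta> = 0"
  obtains g where "hom_on V' act tors_perp act g" "g \<rho> = \<delta>"
  using divisible_extension_cyclic[OF module_on_dual module_on_tors_perp tors_perp_divisible assms]
  by blast

text \<open>For nontorsion \<open>\<xi>\<close>, write \<open>D\<close> for the annihilator of the torsion submodule \<open>T\<close>. All the
  information comes from the homomorphisms of the dual into \<open>D\<close>, of which there are plenty because
  \<open>D\<close> is injective.\<close>

lemma central_pointwise:
  assumes z: "hom_on V' act V' act z"
    and comm: "\<And>g \<rho>. hom_on V' act V' act g \<Longrightarrow> \<rho> \<in> V' \<Longrightarrow> z (g \<rho>) = g (z \<rho>)"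
  shows "\<exists>\<zeta>. \<forall>\<rho>\<in>V'. z \<rho> \<xi> = \<rho> \<zeta>"
proof (cases "\<xi> \<in> tors")
  case True
  then show ?thesis using central_pointwise_torsion[OF z commutes_with_adjointsI[OF comm] True] by metis
next
  case False
  interpret M: module_on V' act by (rule module_on_dual)
  interpret D: module_on tors_perp act by (rule module_on_tors_perp)
  note DV = subsetD[OF tors_perp_subset]
  note zV = hom_onD(1)[OF z] and z_add = hom_onD(2)[OF z] and z_act = hom_onD(3)[OF z]
  have into: "hom_on V' act V' act g" if "hom_on V' act tors_perp act g" for g
    using that DV unfolding hom_on_def by blast
  have pt: "\<exists>\<zeta>\<in>tors. \<forall>\<rho>\<in>V'. z \<rho> \<tau> = \<rho> \<zeta>" if "\<tau> \<in> tors" for \<tau>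
    using central_pointwise_torsion[OF z commutes_with_adjointsI[OF comm] that] by metis
  obtain \<delta>0 where \<delta>0: "\<delta>0 \<in> tors_perp" "\<And>s. s \<noteq> 0 \<Longrightarrow> act s \<delta>0 \<noteq> 0"
    using tors_perp_nontorsion[OF False] by blast

  define P where "P q \<longleftrightarrow> q \<noteq> 0 \<and> (\<exists>p. \<forall>\<delta>\<in>tors_perp. act q (z \<delta>) = act p \<delta>)" for q
  have "\<exists>q. P q"
  proof -
    obtain p q where "q \<noteq> 0" "\<And>\<delta>. \<delta> \<in> tors_perp \<Longrightarrow> act q (z \<delta>) = act p \<delta>"
      using fraction_on_divisible[OF module_on_dual module_on_tors_perp tors_perp_subset
          tors_perp_divisible z comm[OF into] \<delta>0] by blast
    then show ?thesis unfolding P_def by blast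
  qed
  then obtain q where "P q" and qmin: "\<And>h. P h \<Longrightarrow> degree q \<le> degree h"
    using ex_has_least_nat[of P _ degree] by blast
  then obtain p where q: "q \<noteq> 0" and qp: "\<And>\<delta>. \<delta> \<in> tors_perp \<Longrightarrow> act q (z \<delta>) = act p \<delta>"
    unfolding P_def by blast
  \<comment> \<open>A common divisor of \<open>q\<close> and \<open>p\<close> can be cancelled on the divisible module \<open>D\<close>, so minimality of
    \<open>q\<close> makes the fraction reduced, and an element killed by \<open>q\<close> is killed by \<open>p\<close> as well.\<close>
  have q_inj: "\<delta> = 0" if \<delta>: "\<delta> \<in> tors_perp" "act q \<delta> = 0" for \<delta>
  proof (rule ccontr)
    assume "\<delta> \<noteq> 0"
    obtain g where g: "act g \<delta> = 0" "\<And>k. act k \<delta> = 0 \<Longrightarrow> g dvd k"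
      using D.annihilator[OF \<delta>(1)] by blast
    obtain h where h: "q = g * h" using g(2)[OF \<delta>(2)] by blast
    have "act p \<delta> = z (act q \<delta>)" using qp[OF \<delta>(1)] z_act[OF DV[OF \<delta>(1)]] by simp
    also have "\<dots> = 0" unfolding \<delta>(2) by (rule hom_on_zero[OF module_on_dual z])
    finally obtain p' where p': "p = g * p'" using g(2) by blast
    have nz: "g \<noteq> 0" "h \<noteq> 0" using q h by auto
    have "degree g \<noteq> 0"
      using D.unit_annihilates_zero[OF \<delta>(1) g(1)] nz \<open>\<delta> \<noteq> 0\<close>
      by (auto simp: is_unit_iff_degree)
    then have "degree h < degree q" using nz by (simp add: h degree_mult_eq)
    moreover have "act h (z \<epsilon>) = act p' \<epsilon>" if \<epsilon>: "\<epsilon> \<in> tors_perp" for \<epsilon>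
    proof -
      obtain \<epsilon>' where \<epsilon>': "\<epsilon>' \<in> tors_perp" "act g \<epsilon>' = \<epsilon>" using tors_perp_divisible[OF nz(1) \<epsilon>] by blast
      have "act h (z \<epsilon>) = act h (act g (z \<epsilon>'))" using z_act[OF DV[OF \<epsilon>'(1)], of g] \<epsilon>'(2) by simp
      also have "\<dots> = act q (z \<epsilon>')" using zV[OF DV[OF \<epsilon>'(1)]] by (simp add: h mult.commute)
      also have "\<dots> = act p \<epsilon>'" by (rule qp[OF \<epsilon>'(1)])
      also have "\<dots> = act p' (act g \<epsilon>')" using DV[OF \<epsilon>'(1)] by (simp add: p' mult.commute)
      finally show ?thesis using \<epsilon>'(2) by simp
    qed
    then have "P h" using nz unfolding P_def by blast
    ultimately show False using qmin by force
  qed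

  define y where "y \<rho> = act q (z \<rho>) + act (- p) \<rho>" for \<rho>
  have yV: "y \<rho> \<in> V'" if "\<rho> \<in> V'" for \<rho>
    using that zV[OF that] by (simp add: y_def)
  have y_apply: "y \<rho> v = z \<rho> (scale q v) - \<rho> (scale p v)" if "\<rho> \<in> V'" for \<rho> v
    using that by (simp add: y_def act_apply dual_minus)
  have y_act: "y (act k \<rho>) = act k (y \<rho>)" if "\<rho> \<in> V'" for k \<rho>
    using that zV[OF that] z_act[OF that] by (simp add: y_def M.add_right mult.commute)
  have y_D: "y \<delta> = 0" if "\<delta> \<in> tors_perp" for \<delta>
    using qp[OF that] M.minus_left[OF DV[OF that], of p] by (simp add: y_def)
  \<comment> \<open>\<open>g\<close> commutes with \<open>y\<close> and maps into \<open>D\<close>, where \<open>y\<close> vanishes.\<close>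
  have g_y: "g (y \<rho>) = 0" if g: "hom_on V' act tors_perp act g" and \<rho>: "\<rho> \<in> V'" for g \<rho>
  proof -
    have "g (y \<rho>) = act q (g (z \<rho>)) + act (- p) (g \<rho>)"
      using hom_onD(2,3)[OF g] \<rho> zV[OF \<rho>] by (simp add: y_def)
    also have "\<dots> = y (g \<rho>)" using comm[OF into[OF g] \<rho>] by (simp add: y_def)
    also have "\<dots> = 0" by (rule y_D[OF hom_onD(1)[OF g \<rho>]])
    finally show ?thesis .
  qed
  have y_tors: "\<exists>s. s \<noteq> 0 \<and> act s (y \<rho>) = 0" if \<rho>: "\<rho> \<in> V'" for \<rho>
  proof (rule ccontr)
    assume "\<not> ?thesis"
    then have "act k \<delta>0 = 0" if "act k (y \<rho>) = 0" for k
      using that D.zero_left[OF \<delta>0(1)] by (cases "k = 0") auto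
    then obtain g where "hom_on V' act tors_perp act g" "g (y \<rho>) = \<delta>0"
      using hom_into_tors_perp[OF yV[OF \<rho>] \<delta>0(1)] by blast
    then have "\<delta>0 = 0" using g_y \<rho> by metis
    then show False using \<delta>0(2)[of 1] by simp
  qed
  \<comment> \<open>Multiplication by \<open>s\<close> on the cyclic module generated by \<open>y \<rho>\<close> extends to a homomorphism from
    the dual into \<open>D\<close>, which must kill \<open>y \<rho>\<close>.\<close>
  have y_perp: "act s (y \<rho>) = 0" if s: "act s (y \<rho>) \<in> tors_perp" and \<rho>: "\<rho> \<in> V'" for s \<rho>
  proof -
    have "act k (act s (y \<rho>)) = 0" if "act k (y \<rho>) = 0" for k
    proof -
      have "act k (act s (y \<rho>)) = act s (act k (y \<rho>))" using yV[OF \<rho>] by (simp add: mult.commute)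
      then show ?thesis using that by simp
    qed
    then obtain g where "hom_on V' act tors_perp act g" "g (y \<rho>) = act s (y \<rho>)"
      using hom_into_tors_perp[OF yV[OF \<rho>] s] by blast
    then show ?thesis using g_y \<rho> by metis
  qed

  \<comment> \<open>On torsion vectors \<open>y\<close> is the adjoint of a module endomorphism \<open>d\<close> of \<open>T\<close>; the image of \<open>d\<close> is a
    torsion module on which every functional is torsion, hence it is bounded.\<close>
  have "\<exists>\<zeta>\<in>tors. \<forall>\<rho>\<in>V'. y \<rho> \<tau> = \<rho> \<zeta>" if \<tau>: "\<tau> \<in> tors" for \<tau>
  proof -
    obtain \<zeta> where \<zeta>: "\<zeta> \<in> tors" "\<And>\<rho>. \<rho> \<in> V' \<Longrightarrow> z \<rho> (scale q \<tau>) = \<rho> \<zeta>"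
      using pt[OF subspace_scale[OF subspace_tors \<tau>]] by blast
    have "y \<rho> \<tau> = \<rho> (\<zeta> - scale p \<tau>)" if "\<rho> \<in> V'" for \<rho>
      using that \<zeta>(2)[OF that] by (simp add: y_apply dual_diff)
    moreover have "\<zeta> - scale p \<tau> \<in> tors"
      using \<zeta>(1) \<tau> subspace_diff[OF subspace_tors] subspace_scale[OF subspace_tors] by blast
    ultimately show ?thesis by blast
  qed
  then obtain d where d: "\<And>\<tau>. \<tau> \<in> tors \<Longrightarrow> d \<tau> \<in> tors"
      and yd: "\<And>\<tau> \<rho>. \<tau> \<in> tors \<Longrightarrow> \<rho> \<in> V' \<Longrightarrow> y \<rho> \<tau> = \<rho> (d \<tau>)"
    by metis
  have d_scale: "d (scale k \<tau>) = scale k (d \<tau>)" if \<tau>: "\<tau> \<in> tors" for k \<tau>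
  proof (rule dual_eqI)
    fix \<rho> assume \<rho>: "\<rho> \<in> V'"
    have "\<rho> (d (scale k \<tau>)) = act k (y \<rho>) \<tau>"
      using yd[OF subspace_scale[OF subspace_tors \<tau>] \<rho>] by (simp add: act_apply)
    also have "\<dots> = act k \<rho> (d \<tau>)" using yd[OF \<tau>, of "act k \<rho>"] \<rho> by (simp add: y_act)
    finally show "\<rho> (d (scale k \<tau>)) = \<rho> (scale k (d \<tau>))" by (simp add: act_apply)
  qed
  have d_add: "d (\<sigma> + \<tau>) = d \<sigma> + d \<tau>" if \<tau>: "\<sigma> \<in> tors" "\<tau> \<in> tors" for \<sigma> \<tau>
  proof (rule dual_eqI)
    fix \<rho> assume \<rho>: "\<rho> \<in> V'"
    show "\<rho> (d (\<sigma> + \<tau>)) = \<rho> (d \<sigma> + d \<tau>)"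
      using yd[OF subspace_add[OF subspace_tors \<tau>] \<rho>] yd[OF \<tau>(1) \<rho>] yd[OF \<tau>(2) \<rho>]
        dual_add[OF yV[OF \<rho>], of \<sigma> \<tau>] dual_add[OF \<rho>, of "d \<sigma>" "d \<tau>"] by simp
  qed
  have L: "subspace (d ` tors)"
  proof (rule subspaceI)
    have "d 0 = 0" using d_scale[OF subspace_0[OF subspace_tors], of 0] by simp
    then show "0 \<in> d ` tors" using subspace_0[OF subspace_tors] by (metis imageI)
    show "u + v \<in> d ` tors" if uv: "u \<in> d ` tors" "v \<in> d ` tors" for u v
    proof -
      obtain \<sigma> \<tau> where st: "u = d \<sigma>" "\<sigma> \<in> tors" "v = d \<tau>" "\<tau> \<in> tors" using uv by blast
      then have "u + v = d (\<sigma> + \<tau>)" by (simp add: d_add)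
      then show ?thesis using subspace_add[OF subspace_tors st(2,4)] by blast
    qed
    show "scale c u \<in> d ` tors" if u: "u \<in> d ` tors" for c u
    proof -
      obtain \<tau> where t: "u = d \<tau>" "\<tau> \<in> tors" using u by blast
      then have "scale c u = d (scale c \<tau>)" by (simp add: d_scale)
      then show ?thesis using subspace_scale[OF subspace_tors t(2)] by blast
    qed
  qed
  have "\<exists>s. s \<noteq> 0 \<and> (\<forall>x\<in>d ` tors. scale s x = 0)"
  proof (rule bounded_if_dual_torsion[OF L])
    show "\<exists>p. p \<noteq> 0 \<and> scale p x = 0" if "x \<in> d ` tors" for x
      using that d unfolding tors_def by blast
    show "\<exists>s. s \<noteq> 0 \<and> (\<forall>x\<in>d ` tors. \<rho> (scale s x) = 0)" if \<rho>: "\<rho> \<in> V'" for \<rho>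
    proof -
      obtain s where s: "s \<noteq> 0" "act s (y \<rho>) = 0" using y_tors[OF \<rho>] by blast
      have "\<rho> (scale s (d \<tau>)) = 0" if \<tau>: "\<tau> \<in> tors" for \<tau>
      proof -
        have "\<rho> (scale s (d \<tau>)) = y \<rho> (scale s \<tau>)"
          using yd[OF subspace_scale[OF subspace_tors \<tau>] \<rho>] d_scale[OF \<tau>] by simp
        also have "\<dots> = act s (y \<rho>) \<tau>" by (simp add: act_apply)
        finally show ?thesis using s(2) by simp
      qed
      then show ?thesis using s(1) by blast
    qed
  qed
  then obtain s0 where s0: "s0 \<noteq> 0" "\<And>\<tau>. \<tau> \<in> tors \<Longrightarrow> scale s0 (d \<tau>) = 0" by blast
  define Q where "Q s \<longleftrightarrow> s \<noteq> 0 \<and> (\<forall>\<rho>\<in>V'. act s (y \<rho>) = 0)" for s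
  have "Q s0"
    unfolding Q_def
  proof (intro conjI ballI)
    fix \<rho> assume \<rho>: "\<rho> \<in> V'"
    have "act s0 (y \<rho>) \<tau> = 0" if \<tau>: "\<tau> \<in> tors" for \<tau>
      using yd[OF subspace_scale[OF subspace_tors \<tau>] \<rho>] d_scale[OF \<tau>] s0(2)[OF \<tau>] \<rho>
      by (simp add: act_apply)
    then have "act s0 (y \<rho>) \<in> tors_perp" using yV[OF \<rho>] unfolding tors_perp_def by simp
    then show "act s0 (y \<rho>) = 0" by (rule y_perp[OF _ \<rho>])
  qed (rule s0(1))
  then obtain s where "Q s" and smin: "\<And>h. Q h \<Longrightarrow> degree s \<le> degree h"
    using ex_has_least_nat[of Q s0 degree] by blast
  then have s: "s \<noteq> 0" and sy: "\<And>\<rho>. \<rho> \<in> V' \<Longrightarrow> act s (y \<rho>) = 0"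
    unfolding Q_def by blast+
  \<comment> \<open>If \<open>\<delta> \<in> D\<close> had a nontrivial annihilator \<open>(g)\<close> with \<open>s = g h\<close>, minimality of \<open>s\<close> would give a
    nonzero \<open>w = h (y \<rho>)\<close>. Its annihilator \<open>(g')\<close> contains \<open>g = g' k\<close>, so \<open>w \<mapsto> k \<delta> \<noteq> 0\<close> would extend
    to a homomorphism into \<open>D\<close> that does not kill \<open>y \<rho>\<close>.\<close>
  have s_inj: "\<delta> = 0" if \<delta>: "\<delta> \<in> tors_perp" "act s \<delta> = 0" for \<delta>
  proof (rule ccontr)
    assume "\<delta> \<noteq> 0"
    obtain g where g: "act g \<delta> = 0" "\<And>k. act k \<delta> = 0 \<Longrightarrow> g dvd k"
      using D.annihilator[OF \<delta>(1)] by blast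
    obtain h where h: "s = g * h" using g(2)[OF \<delta>(2)] by blast
    have nz: "g \<noteq> 0" "h \<noteq> 0" using s h by auto
    have "degree g \<noteq> 0"
      using D.unit_annihilates_zero[OF \<delta>(1) g(1)] nz \<open>\<delta> \<noteq> 0\<close>
      by (auto simp: is_unit_iff_degree)
    then have "degree h < degree s" using nz by (simp add: h degree_mult_eq)
    then have "\<not> Q h" using smin by force
    then obtain \<rho> where \<rho>: "\<rho> \<in> V'" "act h (y \<rho>) \<noteq> 0" using nz unfolding Q_def by blast
    define w where "w = act h (y \<rho>)"
    have w: "w \<in> V'" unfolding w_def using yV[OF \<rho>(1)] by simp
    have gw: "act g w = 0" using sy[OF \<rho>(1)] yV[OF \<rho>(1)] by (simp add: w_def h)
    obtain g' where g': "act g' w = 0" "\<And>k. act k w = 0 \<Longrightarrow> g' dvd k"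
      using M.annihilator[OF w] by blast
    obtain k where k: "g = g' * k" using g'(2)[OF gw] by blast
    have "act l (act k \<delta>) = 0" if "act l w = 0" for l
    proof -
      obtain m where "l = g' * m" using g'(2)[OF \<open>act l w = 0\<close>] by blast
      then have "act l (act k \<delta>) = act m (act g \<delta>)" using \<delta>(1) by (simp add: k mult_ac)
      then show ?thesis using g(1) by simp
    qed
    then obtain f where f: "hom_on V' act tors_perp act f" "f w = act k \<delta>"
      using hom_into_tors_perp[OF w D.scale_mem[OF \<delta>(1)]] by blast
    have "act k \<delta> = act h (f (y \<rho>))" using hom_onD(3)[OF f(1) yV[OF \<rho>(1)]] f(2) by (simp add: w_def)
    also have "\<dots> = 0" using g_y[OF f(1) \<rho>(1)] by simp
    finally have "g' * k dvd 1 * k" using g(2) k by simp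
    moreover have "k \<noteq> 0" using nz k by auto
    ultimately have "g' dvd 1" by (metis dvd_mult_cancel_right)
    then show False using M.unit_annihilates_zero[OF w g'(1)] \<rho>(2) by (simp add: w_def)
  qed

  obtain \<tau> \<eta> where \<tau>: "\<tau> \<in> tors" and \<xi>: "\<xi> = \<tau> + scale q \<eta>"
    using tors_perp_kernel_trivial[OF q_inj] by blast
  obtain \<tau>' \<eta>' where \<tau>': "\<tau>' \<in> tors" and \<eta>: "\<eta> = \<tau>' + scale s \<eta>'"
    using tors_perp_kernel_trivial[OF s_inj] by blast
  obtain \<zeta> where \<zeta>: "\<And>\<rho>. \<rho> \<in> V' \<Longrightarrow> z \<rho> \<tau> = \<rho> \<zeta>" using pt[OF \<tau>] by blast
  have "z \<rho> \<xi> = \<rho> (\<zeta> + scale p \<eta> + d \<tau>')" if \<rho>: "\<rho> \<in> V'" for \<rho>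
  proof -
    have "y \<rho> (scale s \<eta>') = 0" using fun_cong[OF sy[OF \<rho>], of \<eta>'] by (simp add: act_apply)
    then have "y \<rho> \<eta> = \<rho> (d \<tau>')" using yd[OF \<tau>' \<rho>] by (simp add: \<eta> dual_add[OF yV[OF \<rho>]])
    moreover have "z \<rho> \<xi> = \<rho> \<zeta> + z \<rho> (scale q \<eta>)"
      using \<zeta>[OF \<rho>] dual_add[OF zV[OF \<rho>]] by (simp add: \<xi>)
    ultimately show ?thesis using y_apply[OF \<rho>, of \<eta>] by (simp add: dual_add[OF \<rho>] algebra_simps)
  qed
  then show ?thesis by blast
qed

section \<open>Comparison of the two centres\<close>

lemma dual_endos_iff: "T \<in> dual_endos scale \<longleftrightarrow> T \<in> extensional V' \<and> hom_on V' act V' act T"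
  unfolding dual_endos_def hom_on_def PiE_def Pi_def by (auto simp: plus_fun_def)

lemma dual_centre_iff:
  "z \<in> op_centre V' (dual_endos scale) \<longleftrightarrow> z \<in> extensional V' \<and> hom_on V' act V' act z \<and>
    (\<forall>g \<rho>. hom_on V' act V' act g \<longrightarrow> \<rho> \<in> V' \<longrightarrow> z (g \<rho>) = g (z \<rho>))"
proof
  assume z: "z \<in> op_centre V' (dual_endos scale)"
  then have zh: "z \<in> extensional V'" "hom_on V' act V' act z"
    unfolding op_centre_def dual_endos_iff by blast+
  have "z (g \<rho>) = g (z \<rho>)" if g: "hom_on V' act V' act g" and \<rho>: "\<rho> \<in> V'" for g \<rho>
  proof -
    have "hom_on V' act V' act (restrict g V')"
      using hom_onD[OF g] module_on.add_mem[OF module_on_dual] module_on.scale_mem[OF module_on_dual]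
      by (intro hom_onI) simp_all
    then have "restrict g V' \<in> dual_endos scale" by (simp add: dual_endos_iff)
    then have "compose V' z (restrict g V') \<rho> = compose V' (restrict g V') z \<rho>"
      using z unfolding op_centre_def by auto
    then show ?thesis using \<rho> hom_onD(1)[OF zh(2) \<rho>] by (simp add: compose_def)
  qed
  then show "z \<in> extensional V' \<and> hom_on V' act V' act z \<and>
    (\<forall>g \<rho>. hom_on V' act V' act g \<longrightarrow> \<rho> \<in> V' \<longrightarrow> z (g \<rho>) = g (z \<rho>))" using zh by blast
next
  assume "z \<in> extensional V' \<and> hom_on V' act V' act z \<and>
    (\<forall>g \<rho>. hom_on V' act V' act g \<longrightarrow> \<rho> \<in> V' \<longrightarrow> z (g \<rho>) = g (z \<rho>))"
  then show "z \<in> op_centre V' (dual_endos scale)"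
    unfolding op_centre_def by (auto simp: dual_endos_iff compose_def)
qed

lemma module_centre_iff:
  "c \<in> op_centre UNIV (module_endos scale) \<longleftrightarrow> module_hom scale scale c \<and>
    (\<forall>f v. module_hom scale scale f \<longrightarrow> c (f v) = f (c v))"
  unfolding op_centre_def module_endos_def by (auto simp: compose_def fun_eq_iff)

lemma adjoint_op_central:
  assumes c: "module_hom scale scale c"
    and comm: "\<And>g \<rho>. hom_on V' act V' act g \<Longrightarrow> \<rho> \<in> V' \<Longrightarrow> g (\<rho> \<circ> c) = g \<rho> \<circ> c"
  shows "adjoint_op scale c \<in> op_centre V' (dual_endos scale)"
proof -
  interpret M: module_on V' act by (rule module_on_dual)
  have "hom_on V' act V' act (adjoint_op scale c)"
    unfolding adjoint_op_def
    using dual_comp_hom[OF _ c] by (intro hom_onI) (auto simp: act_apply module_hom.scale[OF c])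
  then show ?thesis
    unfolding dual_centre_iff using comm
    by (auto simp: adjoint_op_def dest: hom_onD(1))
qed

text \<open>The relation \<open>q (\<rho> \<circ> c) = p \<rho>\<close> is preserved by \<open>g\<close>, and a functional is determined by its values
  on \<open>q V = V\<close>.\<close>

lemma adjoint_fraction_commutes:
  assumes c: "module_hom scale scale c" and qp: "\<And>v. scale q (c v) = scale p v"
    and surj: "surj (scale q)" and g: "hom_on V' act V' act g" and \<rho>: "\<rho> \<in> V'"
  shows "g (\<rho> \<circ> c) = g \<rho> \<circ> c"
proof
  fix v
  obtain w where w: "v = scale q w" using surj by blast
  have "act q (\<rho> \<circ> c) = act p \<rho>"
    by (auto simp: act_apply module_hom.scale[OF c] qp)
  then have "act q (g (\<rho> \<circ> c)) = act p (g \<rho>)"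
    using hom_onD(3)[OF g dual_comp_hom[OF \<rho> c]] hom_onD(3)[OF g \<rho>] by metis
  then have "act q (g (\<rho> \<circ> c)) w = act p (g \<rho>) w" by (rule fun_cong)
  then show "g (\<rho> \<circ> c) v = (g \<rho> \<circ> c) v"
    by (simp add: act_apply w module_hom.scale[OF c] qp)
qed

text \<open>On the kernel of a polynomial \<open>q\<close> that kills \<open>v\<close> the central \<open>c\<close> is a polynomial \<open>a\<close>. Hence
  \<open>\<rho> \<circ> c\<close> and \<open>a \<rho>\<close> differ by a multiple of \<open>q\<close>, which stays a multiple of \<open>q\<close> under \<open>g\<close> and so
  vanishes at \<open>v\<close>.\<close>

lemma adjoint_torsion_commutes:
  assumes c: "module_hom scale scale c"
    and comm: "\<And>f v. module_hom scale scale f \<Longrightarrow> c (f v) = f (c v)"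
    and tors: "torsion_module scale" and g: "hom_on V' act V' act g" and \<rho>: "\<rho> \<in> V'"
  shows "g (\<rho> \<circ> c) = g \<rho> \<circ> c"
proof
  fix v
  have "commutes_with_adjoints (\<lambda>\<rho>. \<rho> \<circ> c)"
    unfolding commutes_with_adjoints_def using comm by (auto simp: fun_eq_iff)
  moreover obtain q where q: "q \<noteq> 0" "scale q v = 0" using tors unfolding torsion_module_def by blast
  ultimately obtain a where a: "acts_on_kernel (\<lambda>\<rho>. \<rho> \<circ> c) q a"
    using acts_on_kernel_exists[OF adjoint_hom_on[OF c]] by blast
  have \<rho>c: "\<rho> \<circ> c \<in> V'" by (rule dual_comp_hom[OF \<rho> c])
  interpret M: module_on V' act by (rule module_on_dual)
  have "((\<rho> \<circ> c) - act a \<rho>) w = 0" if "scale q w = 0" for w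
    using a \<rho> that unfolding acts_on_kernel_def by (simp add: act_apply)
  then obtain \<sigma> where \<sigma>: "\<sigma> \<in> V'" "(\<rho> \<circ> c) - act a \<rho> = act q \<sigma>"
    using vanishing_on_kernel[OF dual_diff_mem[OF \<rho>c M.scale_mem[OF \<rho>]]] by blast
  have "\<rho> \<circ> c = act a \<rho> + act q \<sigma>" using \<sigma>(2) by (simp add: algebra_simps)
  then have "g (\<rho> \<circ> c) = act a (g \<rho>) + act q (g \<sigma>)"
    using hom_onD(2)[OF g M.scale_mem[OF \<rho>] M.scale_mem[OF \<sigma>(1)]] hom_onD(3)[OF g] \<rho> \<sigma>(1) by simp
  then have "g (\<rho> \<circ> c) v = g \<rho> (scale a v)"
    using q(2) hom_onD(1)[OF g \<sigma>(1)] by (simp add: act_apply)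
  also have "\<dots> = (g \<rho> \<circ> c) v"
    using a hom_onD(1)[OF g \<rho>] q(2) unfolding acts_on_kernel_def by metis
  finally show "g (\<rho> \<circ> c) v = (g \<rho> \<circ> c) v" .
qed

text \<open>Extend the homomorphism \<open>u q \<mapsto> u v\<close> from the ideal \<open>(q)\<close> to the whole ring.\<close>

lemma injective_divisible:
  assumes "injective_module scale" "q \<noteq> 0"
  shows "\<exists>w. scale q w = v"
proof -
  have "\<exists>w. \<forall>u\<in>{u. q dvd u}. scale (u div q) v = scale u w"
  proof (rule injective_module_ideal[OF module_axioms assms(1)])
    show "scale ((a + b) div q) v = scale (a div q) v + scale (b div q) v"
      if "a \<in> {u. q dvd u}" "b \<in> {u. q dvd u}" for a b
      using that by (simp add: scale_left_distrib)
    show "scale (a * b div q) v = scale a (scale (b div q) v)" if "b \<in> {u. q dvd u}" for a b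
      using that by (simp add: div_mult_swap)
  qed auto
  then obtain w where "scale (q div q) v = scale q w" by auto
  then show ?thesis using assms(2) by auto
qed

lemma module_hom_UNIV: "module_hom scale scale f \<longleftrightarrow> hom_on UNIV scale UNIV scale f"
  unfolding module_hom_iff hom_on_def using module_axioms by auto

lemma central_injective_fraction:
  assumes c: "module_hom scale scale c"
    and comm: "\<And>f v. module_hom scale scale f \<Longrightarrow> c (f v) = f (c v)"
    and inj: "injective_module scale" and nt: "\<not> torsion_module scale"
  obtains p q where "q \<noteq> 0" "\<And>v. scale q (c v) = scale p v"
proof -
  obtain \<eta> where \<eta>: "\<And>s. s \<noteq> 0 \<Longrightarrow> scale s \<eta> \<noteq> 0" using nt unfolding torsion_module_def by blast
  show ?thesis
  proof (rule fraction_on_divisible[OF module_on_UNIV module_on_UNIV subset_UNIV])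
    show "\<exists>y\<in>UNIV. scale q y = x" if "q \<noteq> 0" for q x
      using injective_divisible[OF inj that] by blast
    show "hom_on UNIV scale UNIV scale c" using c unfolding module_hom_UNIV .
    show "c (g x) = g (c x)" if "hom_on UNIV scale UNIV scale g" for g x
      using comm that unfolding module_hom_UNIV by blast
  qed (use \<eta> that in \<open>auto\<close>)
qed

text \<open>With \<open>\<kappa>\<close> the coordinate of the free summand and \<open>\<phi> 1\<close> its generator, \<open>w \<mapsto> \<kappa> w \<cdot> v\<close> is an
  endomorphism sending \<open>\<phi> 1\<close> to \<open>v\<close>; commuting \<open>c\<close> past it determines \<open>c v\<close>.\<close>

lemma central_free_summand:
  assumes comm: "\<And>f v. module_hom scale scale f \<Longrightarrow> c (f v) = f (c v)"
    and free: "has_free_rank1_summand scale"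
  obtains p where "\<And>v. c v = scale p v"
proof -
  obtain A B \<phi> where A: "subspace A" and B: "subspace B" and AB: "A \<inter> B = {0}"
    and dec: "\<And>v. \<exists>a\<in>A. \<exists>b\<in>B. v = a + b"
    and \<phi>: "module_hom (*) scale \<phi>" "bij_betw \<phi> UNIV A"
    using free unfolding has_free_rank1_summand_def by blast
  interpret \<phi>: module_hom "(*)" scale \<phi> by (rule \<phi>(1))
  have ex: "\<exists>p. v - \<phi> p \<in> B" for v
  proof -
    obtain a b where "a \<in> A" "b \<in> B" "v = a + b" using dec by blast
    moreover then obtain p where "a = \<phi> p" using \<phi>(2) unfolding bij_betw_def by blast
    ultimately show ?thesis by (intro exI[of _ p]) simp
  qed
  have uniq: "p = q" if "v - \<phi> p \<in> B" "v - \<phi> q \<in> B" for v p q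
  proof -
    have "(v - \<phi> q) - (v - \<phi> p) \<in> B" using subspace_diff[OF B that(2,1)] .
    then have "\<phi> p - \<phi> q \<in> B" by simp
    moreover have "\<phi> p - \<phi> q \<in> A"
      using \<phi>(2) subspace_diff[OF A, of "\<phi> p" "\<phi> q"] unfolding bij_betw_def by blast
    ultimately have "\<phi> p - \<phi> q = 0" using AB by blast
    then have "\<phi> p = \<phi> q" by simp
    then show ?thesis using \<phi>(2) unfolding bij_betw_def by (auto dest: injD)
  qed
  define \<kappa> where "\<kappa> v = (THE p. v - \<phi> p \<in> B)" for v
  have \<kappa>I: "\<kappa> v = p" if "v - \<phi> p \<in> B" for v p
    unfolding \<kappa>_def by (rule the_equality) (use that uniq in blast)+
  have \<kappa>: "v - \<phi> (\<kappa> v) \<in> B" for v using ex[of v] \<kappa>I by metis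
  have \<kappa>_add: "\<kappa> (v + w) = \<kappa> v + \<kappa> w" for v w
    using subspace_add[OF B \<kappa>[of v] \<kappa>[of w]] by (intro \<kappa>I) (simp add: \<phi>.add algebra_simps)
  have \<kappa>_scale: "\<kappa> (scale k v) = k * \<kappa> v" for k v
    using subspace_scale[OF B \<kappa>[of v], of k] by (intro \<kappa>I) (simp add: \<phi>.scale scale_right_diff_distrib)
  have \<kappa>_one: "\<kappa> (\<phi> 1) = 1" using subspace_0[OF B] by (intro \<kappa>I) simp
  have "c v = scale (\<kappa> (c (\<phi> 1))) v" for v
  proof -
    have "module_hom scale scale (\<lambda>w. scale (\<kappa> w) v)"
      unfolding module_hom_iff using module_axioms by (simp add: \<kappa>_add \<kappa>_scale scale_left_distrib)
    then have "c (scale (\<kappa> (\<phi> 1)) v) = scale (\<kappa> (c (\<phi> 1))) v" by (rule comm)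
    then show ?thesis by (simp add: \<kappa>_one)
  qed
  then show ?thesis using that by blast
qed

lemma dual_centre_adjoint:
  assumes "z \<in> op_centre V' (dual_endos scale)"
  shows "\<exists>c\<in>op_centre UNIV (module_endos scale). z = adjoint_op scale c"
proof -
  have z: "z \<in> extensional V'" "hom_on V' act V' act z"
    and comm: "\<And>g \<rho>. hom_on V' act V' act g \<Longrightarrow> \<rho> \<in> V' \<Longrightarrow> z (g \<rho>) = g (z \<rho>)"
    using assms unfolding dual_centre_iff by blast+
  obtain c where c: "\<And>v \<rho>. \<rho> \<in> V' \<Longrightarrow> z \<rho> v = \<rho> (c v)"
    using central_pointwise[OF z(2) comm] by metis
  note zV = hom_onD(1)[OF z(2)]
  have "module_hom scale scale c"
    unfolding module_hom_iff
  proof (intro conjI allI module_axioms)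
    show "c (v + w) = c v + c w" for v w
      by (rule dual_eqI) (simp add: dual_add dual_add[OF zV] flip: c)
    show "c (scale k v) = scale k (c v)" for k v
    proof (rule dual_eqI)
      fix \<rho> assume \<rho>: "\<rho> \<in> V'"
      have "\<rho> (c (scale k v)) = act k (z \<rho>) v" using c[OF \<rho>] by (simp add: act_apply)
      also have "\<dots> = act k \<rho> (c v)"
        using hom_onD(3)[OF z(2) \<rho>] c[OF module_on.scale_mem[OF module_on_dual \<rho>]] by metis
      finally show "\<rho> (c (scale k v)) = \<rho> (scale k (c v))" by (simp add: act_apply)
    qed
  qed
  moreover have "c (f v) = f (c v)" if f: "module_hom scale scale f" for f v
  proof (rule dual_eqI)
    fix \<rho> assume \<rho>: "\<rho> \<in> V'"
    have "\<rho> (c (f v)) = (z \<rho> \<circ> f) v" using c[OF \<rho>] by simp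
    also have "\<dots> = z (\<rho> \<circ> f) v" using comm[OF adjoint_hom_on[OF f] \<rho>] by simp
    also have "\<dots> = \<rho> (f (c v))" using c[OF dual_comp_hom[OF \<rho> f]] by simp
    finally show "\<rho> (c (f v)) = \<rho> (f (c v))" .
  qed
  moreover have "z = adjoint_op scale c"
    using z(1) c unfolding adjoint_op_def by (intro extensionalityI[of _ V']) (auto simp: fun_eq_iff)
  ultimately show ?thesis using module_centre_iff by blast
qed

lemma adjoint_in_dual_centre:
  assumes c: "c \<in> op_centre UNIV (module_endos scale)"
    and V: "torsion_module scale \<or> injective_module scale \<or> has_free_rank1_summand scale"
  shows "adjoint_op scale c \<in> op_centre V' (dual_endos scale)"
proof (rule adjoint_op_central)
  show hom: "module_hom scale scale c" using c unfolding module_centre_iff by blast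
  have comm: "\<And>f v. module_hom scale scale f \<Longrightarrow> c (f v) = f (c v)"
    using c unfolding module_centre_iff by blast
  fix g \<rho> assume g: "hom_on V' act V' act g" and \<rho>: "\<rho> \<in> V'"
  show "g (\<rho> \<circ> c) = g \<rho> \<circ> c"
  proof (cases "torsion_module scale")
    case True
    then show ?thesis using adjoint_torsion_commutes[OF hom comm _ g \<rho>] by blast
  next
    case nt: False
    show ?thesis
    proof (cases "injective_module scale")
      case True
      obtain p q where q: "q \<noteq> 0" "\<And>v. scale q (c v) = scale p v"
        using central_injective_fraction[OF hom comm True nt] by blast
      moreover have "surj (scale q)" using injective_divisible[OF True q(1)] by (metis surjI)
      ultimately show ?thesis using adjoint_fraction_commutes[OF hom _ _ g \<rho>] by blast
    next
      case False
      then obtain p where "\<And>v. c v = scale p v" using central_free_summand[OF comm] V nt by blast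
      then show ?thesis by (intro adjoint_fraction_commutes[OF hom _ _ g \<rho>, of 1 p]) (auto simp: surj_def)
    qed
  qed
qed

end

theorem corollary3p13:
  fixes scale :: "'a::field poly \<Rightarrow> 'v::ab_group_add \<Rightarrow> 'v"
  assumes "module scale"
  shows "(\<forall>z \<in> op_centre (dual scale) (dual_endos scale).
        \<exists>c \<in> op_centre UNIV (module_endos scale). z = adjoint_op scale c) \<and>
    (torsion_module scale \<or> injective_module scale \<or> has_free_rank1_summand scale \<longrightarrow>
      op_centre (dual scale) (dual_endos scale) =
        {adjoint_op scale c | c. c \<in> op_centre UNIV (module_endos scale)})"
proof -
  interpret module scale by fact
  interpret poly_module scale ..
  show ?thesis using dual_centre_adjoint adjoint_in_dual_centre by blast
qed

end
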